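(* Let $J_T$ be an arbitrary period-$T$ Jacobi operator and $\{\lambda_i\}_{i=3}^\infty$ a sequence of complex numbers belonging to $\sigma_{ell}(J_T)$ where any collection $\{\pi,\theta(\lambda_3),\theta(\lambda_4),\dots,\theta(\lambda_n)\}$, $n\ge 3$, is rationally independent, and let $\{\lambda_1,\lambda_2\}\subseteq\sigma_{ell}(J_T)$ where either $0<\theta(\lambda_1)<\theta(\lambda_2)<\frac{\pi}{2}$ or $\frac{\pi}{2}<\theta(\lambda_1)<\theta(\lambda_2)<\pi$. Then for any positive sequence $K(n)$ with $K(n)\to\infty$ arbitrarily slowly as $n\to\infty$, there exist a potential $(q_n)_{n\ge 1}$ with $|q_n|\leq\frac{K(n)}{n}$ for all $n$, and non-zero vectors $(u_{n,i})_{n\geq 1}\in l^2(\mathbb{N};\mathbb{R})$, such that $$(J_T+Q)(u_{n,i})_{n\geq 1}=\lambda_i(u_{n,i})_{n\geq 1}$$ for all $i\ge 1$, where $Q$ is the infinite diagonal matrix with entries $(q_n)$.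
   Context: A period-$T$ Jacobi operator $J_T$ ($T\in\mathbb{N}$) is the operator on $l^2(\mathbb{N})$ given by the tridiagonal symmetric matrix with diagonal entries $b_1,b_2,\dots$ and off-diagonal entries $a_1,a_2,\dots$, where $(a_n)$ and $(b_n)$ are $T$-periodic, $a_n,b_n\in\mathbb{R}$ and $a_n>0$; that is, $(J_Tu)_1=b_1u_1+a_1u_2$ and $(J_Tu)_n=a_{n-1}u_{n-1}+b_nu_n+a_nu_{n+1}$ for $n\ge 2$. The transfer matrices are $$B_i(\lambda)=\begin{pmatrix}0&1\\-\frac{a_{i-1}}{a_i}&\frac{\lambda-b_i}{a_i}\end{pmatrix},\quad i\in\{1,\dots,T\},\ a_0:=a_T,$$ and the monodromy matrix is $M(\lambda)=B_T(\lambda)\cdots B_1(\lambda)$. The generalised interior of the essential spectrum is $\sigma_{ell}(J_T)=\{\lambda\in\mathbb{R} : |\operatorname{Tr}M(\lambda)|<2\}$. For $\lambda\in\sigma_{ell}(J_T)$ the eigenvalues of $M(\lambda)$ are $e^{\pm i\theta(\lambda)}$ with $\theta(\lambda)\in(0,\pi)$; $\theta(\lambda)$ is called the quasi-momentum. A finite collection of real numbers is rationally independent if it is linearly independent over $\mathbb{Q}$. A potential is a real sequence $(q_n)_{n\ge 1}$ converging to zero. *)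

theory Defs
  imports "HOL-Analysis.Analysis"
begin

text \<open>
  Sequences are indexed by \<open>n \<ge> 1\<close>. The value at index \<open>0\<close> of the coefficient sequences
  \<open>a\<close>, \<open>b\<close> and of a potential \<open>q\<close> is never used; elements of \<open>l\<^sup>2\<close> are
  normalised to vanish at index \<open>0\<close>, so that equality in \<open>l\<^sup>2\<close> is equality of functions.
\<close>

definition l2 :: "(nat \<Rightarrow> real) set" where
  "l2 = {u. u 0 = 0 \<and> summable (\<lambda>n. (u n)\<^sup>2)}"

definition periodic_jacobi_coeffs :: "nat \<Rightarrow> (nat \<Rightarrow> real) \<Rightarrow> (nat \<Rightarrow> real) \<Rightarrow> bool" where
  "periodic_jacobi_coeffs T a b \<longleftrightarrow>
     T \<ge> 1 \<and> (\<forall>n\<ge>1. a n > 0 \<and> a (n + T) = a n \<and> b (n + T) = b n)"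

definition jacobi_op :: "(nat \<Rightarrow> real) \<Rightarrow> (nat \<Rightarrow> real) \<Rightarrow> (nat \<Rightarrow> real) \<Rightarrow> (nat \<Rightarrow> real)" where
  "jacobi_op a b u n =
     (if n = 0 then 0
      else if n = 1 then b 1 * u 1 + a 1 * u 2
      else a (n - 1) * u (n - 1) + b n * u n + a n * u (n + 1))"

definition diag_op :: "(nat \<Rightarrow> real) \<Rightarrow> (nat \<Rightarrow> real) \<Rightarrow> (nat \<Rightarrow> real)" where
  "diag_op q u n = q n * u n"

definition is_potential :: "(nat \<Rightarrow> real) \<Rightarrow> bool" where
  "is_potential q \<longleftrightarrow> q \<longlonglongrightarrow> 0"

definition transfer_matrix ::
    "nat \<Rightarrow> (nat \<Rightarrow> real) \<Rightarrow> (nat \<Rightarrow> real) \<Rightarrow> real \<Rightarrow> nat \<Rightarrow> real^2^2" where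
  "transfer_matrix T a b lam i =
     (let a_prev = (if i = 1 then a T else a (i - 1)) in
      vector [vector [0, 1],
              vector [- (a_prev / a i), (lam - b i) / a i]])"

text \<open>The factors are accumulated on the left: the result is \<open>B\<^sub>T ** \<dots> ** B\<^sub>1\<close>.\<close>

definition monodromy :: "nat \<Rightarrow> (nat \<Rightarrow> real) \<Rightarrow> (nat \<Rightarrow> real) \<Rightarrow> real \<Rightarrow> real^2^2" where
  "monodromy T a b lam = fold (\<lambda>i M. transfer_matrix T a b lam i ** M) [1..<Suc T] (mat 1)"

definition sigma_ell :: "nat \<Rightarrow> (nat \<Rightarrow> real) \<Rightarrow> (nat \<Rightarrow> real) \<Rightarrow> real set" where
  "sigma_ell T a b = {lam. \<bar>trace (monodromy T a b lam)\<bar> < 2}"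

definition eigenvalues :: "complex^'n^'n \<Rightarrow> complex set" where
  "eigenvalues A = {z. \<exists>v. v \<noteq> 0 \<and> A *v v = z *s v}"

text \<open>Used only for \<open>lam \<in> sigma_ell T a b\<close>, where the description is uniquely satisfied;
  see the lemma \<open>quasi_momentum\<close> below.\<close>

definition quasi_momentum :: "nat \<Rightarrow> (nat \<Rightarrow> real) \<Rightarrow> (nat \<Rightarrow> real) \<Rightarrow> real \<Rightarrow> real" where
  "quasi_momentum T a b lam =
     (THE \<theta>. 0 < \<theta> \<and> \<theta> < pi \<and>
        eigenvalues (map_matrix complex_of_real (monodromy T a b lam))
          = {exp (\<i> * of_real \<theta>), exp (- \<i> * of_real \<theta>)})"

text \<open>Linear independence of the finite family \<open>xs\<close> in the \<open>\<rat>\<close>-vector space \<open>\<real>\<close>;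
  as a family, so repeated entries count as dependent.\<close>

definition rationally_independent :: "real list \<Rightarrow> bool" where
  "rationally_independent xs \<longleftrightarrow>
     distinct xs \<and> module.independent (\<lambda>(r::rat) (x::real). of_rat r * x) (set xs)"


lemma det_monodromy:
  assumes "periodic_jacobi_coeffs T a b"
  shows "det (monodromy T a b lam) = 1"
proof -
  have pos: "a n > 0" if "n \<ge> 1" for n
    using assms that by (auto simp: periodic_jacobi_coeffs_def)
  have T: "T \<ge> 1" using assms by (auto simp: periodic_jacobi_coeffs_def)
  have "det (fold (\<lambda>i M. transfer_matrix T a b lam i ** M) [1..<Suc k] (mat 1))
          = a T / (if k = 0 then a T else a k)" for k
  proof (induction k)
    case 0
    then show ?case using pos[OF T] by simp
  next
    case (Suc k)
    have "det (transfer_matrix T a b lam (Suc k))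
            = (if k = 0 then a T else a k) / a (Suc k)"
      by (simp add: transfer_matrix_def det_2 Let_def)
    then show ?case using Suc pos[of k] pos[OF T] pos[of "Suc k"]
      by (auto simp: det_mul)
  qed
  from this[of T] show ?thesis using T pos[OF T] by (simp add: monodromy_def)
qed

lemma eigenvalues_iff_det: "z \<in> eigenvalues A \<longleftrightarrow> det (A - mat z) = 0"
proof -
  have "A *v v = z *s v \<longleftrightarrow> (A - mat z) *v v = 0" for v
  proof -
    have "mat z *v v = z *s v"
      by (simp add: vec_eq_iff matrix_vector_mult_def mat_def if_distrib if_distribR
          cong: if_cong)
    then show ?thesis by (simp add: matrix_vector_mult_diff_rdistrib)
  qed
  then have "z \<in> eigenvalues A \<longleftrightarrow> (\<exists>v. v \<noteq> 0 \<and> (A - mat z) *v v = 0)"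
    by (simp add: eigenvalues_def)
  also have "\<dots> \<longleftrightarrow> \<not> invertible (A - mat z)"
    by (auto simp: invertible_left_inverse matrix_left_invertible_ker)
  finally show ?thesis by (simp add: invertible_det_nz)
qed

lemma eigenvalues_monodromy:
  assumes "periodic_jacobi_coeffs T a b" and tr: "trace (monodromy T a b lam) = 2 * cos \<theta>"
  shows "eigenvalues (map_matrix complex_of_real (monodromy T a b lam))
           = {exp (\<i> * of_real \<theta>), exp (- \<i> * of_real \<theta>)}"
proof -
  let ?M = "monodromy T a b lam"
  have d: "?M$1$1 * ?M$2$2 - ?M$1$2 * ?M$2$1 = 1"
    using det_monodromy[OF assms(1), of lam] by (simp add: det_2)
  have t: "?M$1$1 + ?M$2$2 = 2 * cos \<theta>"
    using tr by (simp add: trace_def sum_2)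
  have "det (map_matrix complex_of_real ?M - mat z)
          = (z - exp (\<i> * of_real \<theta>)) * (z - exp (- \<i> * of_real \<theta>))" for z
  proof -
    have "det (map_matrix complex_of_real ?M - mat z)
        = of_real (?M$1$1 * ?M$2$2 - ?M$1$2 * ?M$2$1) - of_real (?M$1$1 + ?M$2$2) * z + z^2"
      by (simp add: det_2 mat_def algebra_simps power2_eq_square)
    also have "\<dots> = 1 - (exp (\<i> * of_real \<theta>) + exp (- \<i> * of_real \<theta>)) * z + z^2"
      unfolding d t by (simp add: cos_exp_eq flip: cos_of_real)
    also have "\<dots> = (z - exp (\<i> * of_real \<theta>)) * (z - exp (- \<i> * of_real \<theta>))"
      by (simp add: algebra_simps power2_eq_square flip: exp_add)
    finally show ?thesis .
  qed
  then show ?thesis by (auto simp: eigenvalues_iff_det)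
qed

lemma quasi_momentum:
  assumes "periodic_jacobi_coeffs T a b" and "lam \<in> sigma_ell T a b"
  shows "0 < quasi_momentum T a b lam" "quasi_momentum T a b lam < pi"
    and "eigenvalues (map_matrix complex_of_real (monodromy T a b lam))
           = {exp (\<i> * of_real (quasi_momentum T a b lam)),
              exp (- \<i> * of_real (quasi_momentum T a b lam))}"
proof -
  let ?E = "\<lambda>\<theta>::real. {exp (\<i> * of_real \<theta>), exp (- \<i> * of_real \<theta>)}"
  let ?P = "\<lambda>\<theta>. 0 < \<theta> \<and> \<theta> < pi \<and>
     eigenvalues (map_matrix complex_of_real (monodromy T a b lam)) = ?E \<theta>"
  define t where "t = trace (monodromy T a b lam) / 2"
  have t: "-1 < t" "t < 1" using assms(2) by (auto simp: t_def sigma_ell_def)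
  have "\<exists>!\<theta>. ?P \<theta>"
  proof (rule ex1I)
    have "trace (monodromy T a b lam) = 2 * cos (arccos t)"
      using t by (simp add: t_def)
    then show "?P (arccos t)"
      using eigenvalues_monodromy[OF assms(1)] arccos_lt_bounded[OF t] by blast
  next
    fix \<theta> assume \<theta>: "?P \<theta>"
    have "trace (monodromy T a b lam) = 2 * cos (arccos t)"
      using t by (simp add: t_def)
    from eigenvalues_monodromy[OF assms(1) this] \<theta> have "?E \<theta> = ?E (arccos t)" by simp
    then have "exp (\<i> * of_real \<theta>) \<in> ?E (arccos t)" by blast
    moreover have "Re (exp (\<i> * of_real s)) = cos s" "Re (exp (- \<i> * of_real s)) = cos s" for s
      by (simp_all add: Re_exp)
    ultimately have "cos \<theta> = cos (arccos t)"
      by (metis insertE singletonD)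
    then show "\<theta> = arccos t"
      using \<theta> arccos_lt_bounded[OF t] cos_inj_pi[of \<theta> "arccos t"] by simp
  qed
  from theI'[OF this] show "0 < quasi_momentum T a b lam" "quasi_momentum T a b lam < pi"
    "eigenvalues (map_matrix complex_of_real (monodromy T a b lam)) = ?E (quasi_momentum T a b lam)"
    unfolding quasi_momentum_def by blast+
qed

end

theory Submission
  imports Defs "HOL-Real_Asymp.Real_Asymp"
begin

text \<open>
  Let \<open>\<phi>\<close> be a complex Floquet solution of the unperturbed equation at an elliptic energy, normalised by its
  Wronskian with \<open>cnj \<phi>\<close>. Every
  solution of the perturbed equation is \<open>u n = Re (\<phi> n * c n)\<close> with an amplitude that changes
  only where the potential acts, by exactly \<open>\<i> * q n * u n * cnj (\<phi> n)\<close> (variation of constants). Suppose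
  that \<open>q (s + n) = x n / s\<close> on a cell of length \<open>L\<close> starting at \<open>s\<close>. Up to \<open>O(1 / s\<^sup>2)\<close>, the amplitude
  \<open>c\<close> then changes by \<open>\<i> / (2 * s) * (Y * c + Z * cnj c)\<close>, where \<open>Y\<close> is the sum of \<open>x * \<bar>\<phi>\<bar>\<^sup>2\<close> over the cell
  and \<open>Z\<close> is the conjugate of the sum of \<open>x * \<phi>\<^sup>2\<close>. If \<open>Z * cnj c = (- Y + 2 * \<i> * r) * c\<close>, the amplitude keeps its
  phase and is multiplied by \<open>1 - r / s\<close>. With \<open>r \<ge> 2 * L\<close> the product of \<open>s\<close> and \<open>\<bar>c\<bar>\<close> does not grow
  from cell to cell, so that \<open>c n = O(1 / n)\<close> is square summable. The weights \<open>x\<close> have a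
  bound that depends only on the finite set of energies under control and on a margin for their phases, and \<open>K\<close> exceeds that
  bound eventually; so the energies are taken under control one after the other, each new one when \<open>s\<close> is
  large enough.

  It remains to choose the numbers \<open>Z\<close> of finitely many energies simultaneously. Over one period \<open>\<phi>\<^sup>2\<close> is
  multiplied by \<open>\<zeta>\<^sup>2 = exp (\<plusminus> 2 * \<i> * \<theta>)\<close>, and energies with different values of \<open>cos (2 * \<theta>)\<close> are
  separated by difference operators acting on the weights (\<open>sampling_annihilate\<close>). Rational independence
  makes these values distinct for \<open>i \<ge> 3\<close>, and those of the first two energies differ from each other, but each of
  the first two may share its value with one later energy. If the squares \<open>\<phi>\<^sup>2\<close> of two such energies
  are not proportional, even after conjugating one of them, two sites and their translates by \<open>T\<close> separate them
  (\<open>dual_functional\<close>). Otherwise they are complex conjugate to each other (\<open>proportional_squares\<close>); this happens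
  for energies symmetric about a constant \<open>b\<close>. Such a mirror pair has conjugate numbers \<open>Z\<close>, and both of its
  amplitudes \<open>c\<close> and \<open>d\<close> can shrink at the same rate \<open>r\<close> exactly when \<open>(- Y + 2 * \<i> * r) * c * d\<close> is real, that is, for
  \<open>r = Y * Im (c * d) / (2 * Re (c * d))\<close>. For \<open>Y > 0\<close> this rate is positive if \<open>c * d\<close> lies in the open
  third quadrant. One nonzero value \<open>q 1\<close> moves it there (\<open>initial_phase_lock\<close>), and since phases drift by
  \<open>O(1 / s\<^sup>2)\<close> per cell only, it never leaves (\<open>cell_step\<close>).
\<close>

section \<open>Real finite functionals on sequences\<close>

text \<open>
  Functionals on complex sequences that read finitely many entries with real weights; the weights
  become the potential on one cell. The inductive form makes closure properties immediate.
\<close>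

inductive sampling :: "((nat \<Rightarrow> complex) \<Rightarrow> complex) \<Rightarrow> bool" where
  point: "sampling (\<lambda>f. f n)"
| add: "sampling F \<Longrightarrow> sampling G \<Longrightarrow> sampling (\<lambda>f. F f + G f)"
| scale: "sampling F \<Longrightarrow> sampling (\<lambda>f. complex_of_real r * F f)"

lemma sampling_shift: "sampling F \<Longrightarrow> sampling (\<lambda>f. F (\<lambda>n. f (n + k)))"
  by (induction rule: sampling.induct) (auto intro: sampling.intros)

lemma sampling_mult: "sampling F \<Longrightarrow> F (\<lambda>n. z * f n) = z * F f"
  by (induction rule: sampling.induct) (auto simp: algebra_simps)

lemma sampling_cnj: "sampling F \<Longrightarrow> F (\<lambda>n. cnj (f n)) = cnj (F f)"
  by (induction rule: sampling.induct) auto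

lemma sampling_weights:
  assumes "sampling F"
  obtains L and x :: "nat \<Rightarrow> real" where "\<And>n. n \<ge> L \<Longrightarrow> x n = 0"
    and "\<And>N f. N \<ge> L \<Longrightarrow> F f = (\<Sum>n<N. complex_of_real (x n) * f n)"
proof -
  have "\<exists>L x. (\<forall>n\<ge>L. x n = 0) \<and> (\<forall>N\<ge>L. \<forall>f. F f = (\<Sum>n<N. complex_of_real (x n) * f n))"
    using assms
  proof (induction rule: sampling.induct)
    case (point k)
    have "f k = (\<Sum>n<N. complex_of_real (if n = k then 1 else 0) * f n)" if "N \<ge> Suc k" for f N
    proof -
      have "(\<Sum>n<N. complex_of_real (if n = k then 1 else 0) * f n) = (\<Sum>n<N. if n = k then f k else 0)"
        by (intro sum.cong) auto
      then show ?thesis using that by simp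
    qed
    then show ?case by (intro exI[of _ "Suc k"] exI[of _ "\<lambda>n. if n = k then 1 else 0"]) auto
  next
    case (add F G)
    then obtain L x L' x' where
      x: "\<forall>n\<ge>L. x n = 0" "\<forall>N\<ge>L. \<forall>f. F f = (\<Sum>n<N. complex_of_real (x n) * f n)" and
      x': "\<forall>n\<ge>L'. x' n = 0" "\<forall>N\<ge>L'. \<forall>f. G f = (\<Sum>n<N. complex_of_real (x' n) * f n)"
      by auto
    show ?case
      by (rule exI[of _ "max L L'"], rule exI[of _ "\<lambda>n. x n + x' n"])
        (use x x' in \<open>auto simp: algebra_simps sum.distrib\<close>)
  next
    case (scale F r)
    then obtain L x where
      x: "\<forall>n\<ge>L. x n = 0" "\<forall>N\<ge>L. \<forall>f. F f = (\<Sum>n<N. complex_of_real (x n) * f n)"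
      by auto
    show ?case
      by (rule exI[of _ L], rule exI[of _ "\<lambda>n. r * x n"])
        (use x in \<open>auto simp: algebra_simps sum_distrib_left\<close>)
  qed
  then show ?thesis using that by blast
qed

definition multiplier :: "nat \<Rightarrow> complex \<Rightarrow> (nat \<Rightarrow> complex) \<Rightarrow> bool" where
  "multiplier T z f \<longleftrightarrow> (\<forall>n. f (n + T) = z * f n)"

text \<open>
  On sequences with multiplier \<open>z\<close> the shift by one period acts as the number \<open>z\<close>, so a polynomial in the
  shift acts as its value at \<open>z\<close>. For \<open>\<bar>z\<bar> = 1\<close> the real quadratic factor \<open>1 - 2 * k * z + z\<^sup>2\<close> equals
  \<open>2 * z * (Re z - k)\<close>; hence the new functional kills exactly the unimodular multipliers whose real part
  lies in \<open>B\<close>, and on all other unimodular ones it is a nonzero multiple of \<open>F\<close>.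
\<close>

lemma sampling_annihilate:
  assumes "sampling F" "finite B"
  shows "\<exists>G. sampling G \<and> (\<forall>f z. multiplier T z f \<longrightarrow>
    G f = (\<Prod>k\<in>B. 1 - 2 * complex_of_real k * z + z\<^sup>2) * F f)"
  using assms(2)
proof (induction B rule: finite_induct)
  case empty
  then show ?case using assms(1) by auto
next
  case (insert k B)
  then obtain G where G: "sampling G"
    "\<And>f z. multiplier T z f \<Longrightarrow> G f = (\<Prod>k\<in>B. 1 - 2 * complex_of_real k * z + z\<^sup>2) * F f"
    by blast
  let ?H = "\<lambda>f. G f + (complex_of_real (- 2 * k) * G (\<lambda>n. f (n + T)) + G (\<lambda>n. f (n + (T + T))))"
  have "sampling ?H"
    by (intro sampling.add sampling.scale G(1) sampling_shift)
  moreover have "?H f = (\<Prod>k\<in>insert k B. 1 - 2 * complex_of_real k * z + z\<^sup>2) * F f"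
    if "multiplier T z f" for f z
  proof -
    have "(\<lambda>n. f (n + T)) = (\<lambda>n. z * f n)" "(\<lambda>n. f (n + (T + T))) = (\<lambda>n. z\<^sup>2 * f n)"
      using that by (simp_all add: multiplier_def power2_eq_square mult.assoc flip: add.assoc)
    then have "?H f = (1 - 2 * complex_of_real k * z + z\<^sup>2) * G f"
      by (simp only: sampling_mult[OF G(1)]) (simp add: algebra_simps)
    then show ?thesis using insert(1,2) G(2)[OF that] by simp
  qed
  ultimately show ?case by blast
qed

text \<open>
  Two sites one period apart have the values \<open>f n\<close> and \<open>z * f n\<close>, and for nonreal \<open>z\<close> the numbers \<open>1\<close> and \<open>z\<close> span
  the complex plane over the reals: real weights at two sites act as one complex weight at one site.
\<close>

lemma sampling_point_complex:
  assumes "Im z \<noteq> 0"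
  shows "\<exists>F. sampling F \<and> (\<forall>f. multiplier T z f \<longrightarrow> F f = \<gamma> * f n)"
proof -
  define \<beta> where "\<beta> = Im \<gamma> / Im z"
  define \<alpha> where "\<alpha> = Re \<gamma> - \<beta> * Re z"
  have "\<gamma> = \<alpha> + \<beta> * z"
    using assms by (simp add: complex_eq_iff \<alpha>_def \<beta>_def)
  moreover have "sampling (\<lambda>f. complex_of_real \<alpha> * f n + complex_of_real \<beta> * f (n + T))"
    by (intro sampling.intros)
  ultimately show ?thesis
    by (intro exI[of _ "\<lambda>f. complex_of_real \<alpha> * f n + complex_of_real \<beta> * f (n + T)"])
      (auto simp: multiplier_def algebra_simps)
qed

section \<open>Floquet solutions at elliptic energies\<close>

text \<open>
  The coefficient sequence with the convention \<open>a\<^sub>0 = a\<^sub>T\<close>, under which the boundary condition reads \<open>u 0 = 0\<close>.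
\<close>

definition ext_coeff :: "nat \<Rightarrow> (nat \<Rightarrow> real) \<Rightarrow> nat \<Rightarrow> real" where
  "ext_coeff T a n = (if n = 0 then a T else a n)"

text \<open>
  The Wronskian of \<open>\<phi>\<close> with its conjugate is constant and nonzero; scaling, and conjugation if necessary, give
  it the value in the last clause and make \<open>\<phi> 0\<close> positive. This normalisation determines \<open>\<phi>\<close>, so that
  proportional solutions of different energies can be compared entry by entry.
\<close>

definition floquet ::
    "nat \<Rightarrow> (nat \<Rightarrow> real) \<Rightarrow> (nat \<Rightarrow> real) \<Rightarrow> real \<Rightarrow> complex \<Rightarrow> (nat \<Rightarrow> complex) \<Rightarrow> bool" where
  "floquet T \<alpha> b lam \<zeta> \<phi> \<longleftrightarrow>
     (\<forall>n. \<alpha> (Suc n) * \<phi> (Suc (Suc n)) + b (Suc n) * \<phi> (Suc n) + \<alpha> n * \<phi> n = lam * \<phi> (Suc n)) \<and>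
     multiplier T \<zeta> \<phi> \<and> cmod \<zeta> = 1 \<and> Im (\<phi> 0) = 0 \<and> Re (\<phi> 0) > 0 \<and>
     (\<forall>n. \<alpha> n * Im (\<phi> (Suc n) * cnj (\<phi> n)) = 1)"

fun jacobi_solution ::
    "(nat \<Rightarrow> real) \<Rightarrow> (nat \<Rightarrow> real) \<Rightarrow> real \<Rightarrow> complex \<Rightarrow> complex \<Rightarrow> nat \<Rightarrow> complex" where
  "jacobi_solution \<alpha> b lam x y 0 = x"
| "jacobi_solution \<alpha> b lam x y (Suc 0) = y"
| "jacobi_solution \<alpha> b lam x y (Suc (Suc n)) =
     ((lam - b (Suc n)) * jacobi_solution \<alpha> b lam x y (Suc n)
       - \<alpha> n * jacobi_solution \<alpha> b lam x y n) / \<alpha> (Suc n)"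

lemma map_matrix_of_real_mult:
  fixes A B :: "real^2^2"
  shows "map_matrix complex_of_real (A ** B) = map_matrix complex_of_real A ** map_matrix complex_of_real B"
  by (simp add: vec_eq_iff matrix_matrix_mult_def map_matrix_def sum_2)

lemma transfer_product_solution:
  fixes v :: "complex^2"
  shows "map_matrix complex_of_real
       (fold (\<lambda>i M. transfer_matrix T a b lam i ** M) [1..<Suc k] (mat 1)) *v v
     = vector [jacobi_solution (ext_coeff T a) b lam (v$1) (v$2) k,
               jacobi_solution (ext_coeff T a) b lam (v$1) (v$2) (Suc k)]"
proof (induction k)
  case 0
  have one: "map_matrix complex_of_real (mat 1 :: real^2^2) = mat 1"
    by (simp add: vec_eq_iff mat_def map_matrix_def)
  show ?case by (simp add: one) (simp add: vec_eq_iff forall_2)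
next
  case (Suc k)
  have "fold (\<lambda>i M. transfer_matrix T a b lam i ** M) [1..<Suc (Suc k)] (mat 1)
     = transfer_matrix T a b lam (Suc k) ** fold (\<lambda>i M. transfer_matrix T a b lam i ** M) [1..<Suc k] (mat 1)"
    by simp
  then show ?case
    by (simp only: map_matrix_of_real_mult Suc.IH flip: matrix_vector_mul_assoc)
      (simp add: vec_eq_iff forall_2 matrix_vector_mult_def sum_2 transfer_matrix_def
        ext_coeff_def Let_def map_matrix_def diff_divide_distrib left_diff_distrib)
qed

context
  fixes T :: nat and a b :: "nat \<Rightarrow> real"
  assumes per: "periodic_jacobi_coeffs T a b"
begin

lemma ext_coeff_pos: "ext_coeff T a n > 0"
  using per by (auto simp: ext_coeff_def periodic_jacobi_coeffs_def)

lemma ext_coeff_periodic: "ext_coeff T a (n + T) = ext_coeff T a n"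
  using per by (auto simp: ext_coeff_def periodic_jacobi_coeffs_def)

lemma jacobi_solution_multiplier:
  assumes "jacobi_solution (ext_coeff T a) b lam x y T = \<zeta> * x"
    and "jacobi_solution (ext_coeff T a) b lam x y (Suc T) = \<zeta> * y"
  shows "multiplier T \<zeta> (jacobi_solution (ext_coeff T a) b lam x y)"
proof -
  let ?\<phi> = "jacobi_solution (ext_coeff T a) b lam x y"
  have "?\<phi> (n + T) = \<zeta> * ?\<phi> n \<and> ?\<phi> (Suc n + T) = \<zeta> * ?\<phi> (Suc n)" for n
  proof (induction n)
    case 0
    then show ?case using assms by simp
  next
    case (Suc n)
    have "b (Suc n + T) = b (Suc n)" using per by (auto simp: periodic_jacobi_coeffs_def)
    then have "?\<phi> (Suc (Suc n) + T) = \<zeta> * ?\<phi> (Suc (Suc n))"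
      using Suc ext_coeff_periodic[of n] ext_coeff_periodic[of "Suc n"] ext_coeff_pos[of "Suc n"]
      by (simp add: field_simps)
    then show ?case using Suc by simp
  qed
  then show ?thesis by (simp add: multiplier_def)
qed

text \<open>
  An eigenvector of the monodromy matrix provides initial values. They are not real up to a constant
  because the eigenvalue \<open>exp (\<i> * \<theta>)\<close> is not real, and this is what makes the Wronskian nonzero.
\<close>

lemma floquet_exists:
  assumes "lam \<in> sigma_ell T a b"
  obtains \<phi> \<zeta> where "floquet T (ext_coeff T a) b lam \<zeta> \<phi>"
    and "\<zeta> = exp (\<i> * quasi_momentum T a b lam) \<or> \<zeta> = exp (- \<i> * quasi_momentum T a b lam)"
proof -
  note main = that
  define \<theta> where "\<theta> = quasi_momentum T a b lam"
  define \<alpha> where "\<alpha> = ext_coeff T a"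
  have \<alpha>: "\<alpha> n > 0" for n using ext_coeff_pos by (simp add: \<alpha>_def)
  define \<zeta> where "\<zeta> = exp (\<i> * complex_of_real \<theta>)"
  have \<theta>: "0 < \<theta>" "\<theta> < pi" using quasi_momentum[OF per assms] by (auto simp: \<theta>_def)
  have "\<zeta> \<in> eigenvalues (map_matrix complex_of_real (monodromy T a b lam))"
    using quasi_momentum(3)[OF per assms] by (simp add: \<theta>_def \<zeta>_def)
  then obtain v :: "complex^2" where v: "v \<noteq> 0"
    "map_matrix complex_of_real (monodromy T a b lam) *v v = \<zeta> *s v"
    by (auto simp: eigenvalues_def)
  define x y where "x = v$1" and "y = v$2"
  define \<phi> where "\<phi> = jacobi_solution \<alpha> b lam x y"
  have xy: "x \<noteq> 0 \<or> y \<noteq> 0" using v(1) by (auto simp: vec_eq_iff forall_2 x_def y_def)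
  have "\<zeta> *s v = vector [\<phi> T, \<phi> (Suc T)]"
    using v(2) transfer_product_solution[of T a b lam T v]
    by (simp add: monodromy_def \<phi>_def x_def y_def \<alpha>_def)
  then have "\<phi> T = \<zeta> * x" "\<phi> (Suc T) = \<zeta> * y"
    by (simp_all add: vec_eq_iff forall_2 x_def y_def)
  then have mult: "multiplier T \<zeta> \<phi>"
    unfolding \<phi>_def \<alpha>_def by (rule jacobi_solution_multiplier)
  have rec: "\<alpha> (Suc n) * \<phi> (Suc (Suc n)) + b (Suc n) * \<phi> (Suc n) + \<alpha> n * \<phi> n = lam * \<phi> (Suc n)" for n
    using \<alpha>[of "Suc n"] by (simp add: \<phi>_def field_simps)
  define W where "W = \<alpha> 0 * Im (\<phi> (Suc 0) * cnj (\<phi> 0))"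
  have W: "\<alpha> n * Im (\<phi> (Suc n) * cnj (\<phi> n)) = W" for n
  proof (induction n)
    case (Suc n)
    have eq: "\<alpha> (Suc n) * \<phi> (Suc (Suc n)) = (lam - b (Suc n)) * \<phi> (Suc n) - \<alpha> n * \<phi> n"
      using rec[of n] by (simp add: algebra_simps)
    have "\<alpha> (Suc n) * \<phi> (Suc (Suc n)) * cnj (\<phi> (Suc n))
        = (lam - b (Suc n)) * (\<phi> (Suc n) * cnj (\<phi> (Suc n))) - \<alpha> n * (\<phi> n * cnj (\<phi> (Suc n)))"
      unfolding eq by (simp add: algebra_simps)
    from arg_cong[OF this, of Im] Suc show ?case by (simp add: algebra_simps)
  qed (simp add: W_def)
  have sgz: "Im \<zeta> \<noteq> 0" using sin_gt_zero[OF \<theta>] by (simp add: \<zeta>_def Im_exp)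
  \<comment> \<open>if the Wronskian vanished, the solution would be real up to a constant, and so would its multiplier\<close>
  have W0: "W \<noteq> 0"
  proof
    assume "W = 0"
    then have im: "Im (y * cnj x) = 0" using \<alpha>[of 0] by (simp add: W_def \<phi>_def)
    have "\<exists>k. k \<noteq> 0 \<and> x / k \<in> \<real> \<and> y / k \<in> \<real>"
    proof (cases "x = 0")
      case True
      then show ?thesis using xy by (intro exI[of _ y]) auto
    next
      case False
      have "y / x = y * cnj x / (complex_of_real ((cmod x)\<^sup>2))"
        using complex_div_cnj[of y x] by simp
      then have "y / x \<in> \<real>"
        using im by (metis Reals_divide Reals_of_real complex_is_Real_iff)
      then show ?thesis using False by (intro exI[of _ x]) auto
    qed
    then obtain k where k: "k \<noteq> 0" "x / k \<in> \<real>" "y / k \<in> \<real>" by blast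
    have real: "\<phi> n / k \<in> \<real> \<and> \<phi> (Suc n) / k \<in> \<real>" for n
    proof (induction n)
      case (Suc n)
      have "\<phi> (Suc (Suc n)) / k = (complex_of_real (lam - b (Suc n)) * (\<phi> (Suc n) / k)
          - complex_of_real (\<alpha> n) * (\<phi> n / k)) / complex_of_real (\<alpha> (Suc n))"
        using k(1) \<alpha>[of "Suc n"] by (simp add: \<phi>_def field_simps)
      also have "\<dots> \<in> \<real>" using Suc by (intro Reals_divide[OF _ Reals_of_real] Reals_diff Reals_mult[OF Reals_of_real]) auto
      finally show ?case using Suc by blast
    qed (use k in \<open>simp add: \<phi>_def\<close>)
    have "\<zeta> \<in> \<real>"
    proof (cases "x = 0")
      case True
      then have "\<zeta> = (\<phi> (Suc T) / k) / (y / k)" using xy k(1) \<open>\<phi> (Suc T) = \<zeta> * y\<close> by simp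
      then show ?thesis using real[of T] k by (metis Reals_divide)
    next
      case False
      then have "\<zeta> = (\<phi> T / k) / (x / k)" using k(1) \<open>\<phi> T = \<zeta> * x\<close> by simp
      then show ?thesis using real[of T] k by (metis Reals_divide)
    qed
    then show False using sgz by (simp add: complex_is_Real_iff)
  qed
  \<comment> \<open>conjugation makes the Wronskian positive, a factor makes it one and the initial value positive\<close>
  have normalise: thesis
    if W': "\<And>n. \<alpha> n * Im (\<psi> (Suc n) * cnj (\<psi> n)) = V" "V > 0"
      and rec': "\<And>n. \<alpha> (Suc n) * \<psi> (Suc (Suc n)) + b (Suc n) * \<psi> (Suc n) + \<alpha> n * \<psi> n = lam * \<psi> (Suc n)"
      and m': "multiplier T \<eta> \<psi>" "\<eta> = \<zeta> \<or> \<eta> = cnj \<zeta>" for \<psi> :: "nat \<Rightarrow> complex" and V \<eta>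
  proof -
    have p0: "\<psi> 0 \<noteq> 0" using W'(1)[of 0] W'(2) by auto
    define g where "g = cnj (\<psi> 0) / (cmod (\<psi> 0) * sqrt V)"
    have g2: "g * cnj g = 1 / V"
    proof -
      have "(cmod g)\<^sup>2 = 1 / V" using p0 W'(2)
        by (simp add: g_def norm_divide norm_mult power_divide power_mult_distrib)
      then show ?thesis by (metis complex_norm_square of_real_1 of_real_divide)
    qed
    have g0: "g * \<psi> 0 = cmod (\<psi> 0) / sqrt V"
    proof -
      have "cnj (\<psi> 0) * \<psi> 0 = complex_of_real (cmod (\<psi> 0) * cmod (\<psi> 0))"
        by (metis complex_norm_square mult.commute power2_eq_square)
      then show ?thesis using p0 by (simp add: g_def)
    qed
    have fl: "floquet T \<alpha> b lam \<eta> (\<lambda>n. g * \<psi> n)"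
      unfolding floquet_def
    proof (intro conjI allI)
      fix n
      show "\<alpha> (Suc n) * (g * \<psi> (Suc (Suc n))) + b (Suc n) * (g * \<psi> (Suc n)) + \<alpha> n * (g * \<psi> n)
          = lam * (g * \<psi> (Suc n))"
        using arg_cong[OF rec'[of n], of "\<lambda>z. g * z"] by (simp add: algebra_simps)
      have "g * \<psi> (Suc n) * cnj (g * \<psi> n) = complex_of_real (1 / V) * (\<psi> (Suc n) * cnj (\<psi> n))"
      proof -
        have "g * \<psi> (Suc n) * cnj (g * \<psi> n) = (g * cnj g) * (\<psi> (Suc n) * cnj (\<psi> n))"
          by (simp add: algebra_simps)
        then show ?thesis by (simp add: g2)
      qed
      then have "Im (g * \<psi> (Suc n) * cnj (g * \<psi> n)) = Im (\<psi> (Suc n) * cnj (\<psi> n)) / V"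
        by (simp only: Im_complex_of_real Re_complex_of_real times_complex.sel) simp
      then show "\<alpha> n * Im (g * \<psi> (Suc n) * cnj (g * \<psi> n)) = 1"
        using W'(1)[of n] W'(2) by simp
      show "multiplier T \<eta> (\<lambda>n. g * \<psi> n)" using m' by (simp add: multiplier_def algebra_simps)
      show "cmod \<eta> = 1" using m' by (auto simp: \<zeta>_def)
      show "Im (g * \<psi> 0) = 0" unfolding g0 by simp
      show "Re (g * \<psi> 0) > 0" unfolding g0 using p0 W'(2) by simp
    qed
    have "cnj \<zeta> = exp (- \<i> * complex_of_real \<theta>)"
      by (simp add: \<zeta>_def exp_cnj)
    then have "\<eta> = exp (\<i> * \<theta>) \<or> \<eta> = exp (- \<i> * \<theta>)"
      using m'(2) by (simp add: \<zeta>_def)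
    with fl show thesis unfolding \<theta>_def \<alpha>_def by (rule main)
  qed
  show thesis
  proof (cases "W > 0")
    case True
    then show ?thesis using normalise[of \<phi> W \<zeta>] W rec mult by blast
  next
    case False
    have r: "\<alpha> (Suc n) * cnj (\<phi> (Suc (Suc n))) + b (Suc n) * cnj (\<phi> (Suc n)) + \<alpha> n * cnj (\<phi> n)
        = lam * cnj (\<phi> (Suc n))" for n
      using arg_cong[OF rec[of n], of cnj] by simp
    have w: "\<alpha> n * Im (cnj (\<phi> (Suc n)) * cnj (cnj (\<phi> n))) = - W" for n
      using W[of n] by (simp add: algebra_simps)
    show ?thesis
      by (rule normalise[of "\<lambda>n. cnj (\<phi> n)" "- W" "cnj \<zeta>"])
        (use False W0 mult r w in \<open>auto simp: multiplier_def\<close>)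
  qed
qed

end

section \<open>Families of energies with few resonances\<close>

text \<open>
  The assumption \<open>nonreal\<close> excludes the quasi-momentum \<open>\<pi> / 2\<close>, where \<open>\<phi>\<^sup>2\<close> and its conjugate have the same
  multiplier. Since \<open>Re (\<zeta>\<^sup>2) = cos (2 * \<theta>)\<close>, the assumption \<open>cluster\<close> says that at most two energies of the
  family share a frequency up to sign.
\<close>

locale resonance_family =
  fixes T :: nat and \<alpha> b :: "nat \<Rightarrow> real" and \<Lambda> :: "real set"
    and \<Phi> :: "real \<Rightarrow> nat \<Rightarrow> complex" and \<zeta> :: "real \<Rightarrow> complex"
  assumes T_pos: "T \<ge> 1"
    and \<alpha>_pos: "\<alpha> n > 0"
    and floquet: "lam \<in> \<Lambda> \<Longrightarrow> floquet T \<alpha> b lam (\<zeta> lam) (\<Phi> lam)"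
    and nonreal: "lam \<in> \<Lambda> \<Longrightarrow> Im ((\<zeta> lam)\<^sup>2) \<noteq> 0"
    and cluster: "\<lbrakk>lam \<in> \<Lambda>; mu \<in> \<Lambda>; nu \<in> \<Lambda>; Re ((\<zeta> lam)\<^sup>2) = Re ((\<zeta> mu)\<^sup>2);
      Re ((\<zeta> mu)\<^sup>2) = Re ((\<zeta> nu)\<^sup>2)\<rbrakk> \<Longrightarrow> lam = mu \<or> lam = nu \<or> mu = nu"
begin

text \<open>
  The one kind of resonance in which the squares of two Floquet solutions cannot be separated by any weights.
\<close>

definition mirror :: "real \<Rightarrow> real \<Rightarrow> bool" where
  "mirror lam mu \<longleftrightarrow> (\<forall>n. (\<Phi> mu n)\<^sup>2 = cnj ((\<Phi> lam n)\<^sup>2))"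

lemma wronskian: "lam \<in> \<Lambda> \<Longrightarrow> \<alpha> n * Im (\<Phi> lam (Suc n) * cnj (\<Phi> lam n)) = 1"
  using floquet unfolding floquet_def by blast

lemma solution_nonzero: "lam \<in> \<Lambda> \<Longrightarrow> \<Phi> lam n \<noteq> 0"
  using wronskian[of lam n] by auto

lemma recurrence:
  "lam \<in> \<Lambda> \<Longrightarrow> \<alpha> (Suc n) * \<Phi> lam (Suc (Suc n)) + b (Suc n) * \<Phi> lam (Suc n) + \<alpha> n * \<Phi> lam n
     = lam * \<Phi> lam (Suc n)"
  using floquet unfolding floquet_def by blast

lemma initial_value: "lam \<in> \<Lambda> \<Longrightarrow> \<Phi> lam 0 = complex_of_real (Re (\<Phi> lam 0)) \<and> Re (\<Phi> lam 0) > 0"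
  using floquet unfolding floquet_def by (simp add: complex_eq_iff)

lemma unimodular: "lam \<in> \<Lambda> \<Longrightarrow> cmod (\<zeta> lam) = 1"
  using floquet unfolding floquet_def by blast

lemma square_multiplier: "lam \<in> \<Lambda> \<Longrightarrow> multiplier T ((\<zeta> lam)\<^sup>2) (\<lambda>n. (\<Phi> lam n)\<^sup>2)"
  using floquet[of lam] by (simp add: floquet_def multiplier_def power_mult_distrib)

lemma modulus_periodic:
  "lam \<in> \<Lambda> \<Longrightarrow> multiplier T 1 (\<lambda>n. complex_of_real ((cmod (\<Phi> lam n))\<^sup>2))"
  using floquet[of lam] by (simp add: floquet_def multiplier_def norm_mult)

lemma shift_periods: "lam \<in> \<Lambda> \<Longrightarrow> \<Phi> lam (j * T + n) = \<zeta> lam ^ j * \<Phi> lam n"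
proof (induction j)
  case (Suc j)
  have "\<Phi> lam (Suc j * T + n) = \<Phi> lam ((j * T + n) + T)" by (simp add: algebra_simps)
  also have "\<dots> = \<zeta> lam * \<Phi> lam (j * T + n)"
    using floquet[OF Suc.prems] by (simp add: floquet_def multiplier_def)
  finally show ?case using Suc by simp
qed simp

lemma solution_bounded:
  assumes "lam \<in> \<Lambda>"
  shows "(cmod (\<Phi> lam n))\<^sup>2 \<le> (\<Sum>k<T. (cmod (\<Phi> lam k))\<^sup>2)"
proof -
  have "\<Phi> lam n = \<zeta> lam ^ (n div T) * \<Phi> lam (n mod T)"
    using shift_periods[OF assms, of "n div T" "n mod T"] by simp
  then have "cmod (\<Phi> lam n) = cmod (\<Phi> lam (n mod T))"
    by (simp add: norm_mult norm_power unimodular[OF assms])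
  moreover have "n mod T < T" using T_pos by simp
  ultimately show ?thesis
    using member_le_sum[of "n mod T" "{..<T}" "\<lambda>k. (cmod (\<Phi> lam k))\<^sup>2"] by simp
qed

lemma mirror_sym: "mirror lam mu \<Longrightarrow> mirror mu lam"
  by (simp add: mirror_def)

lemma mirror_multiplier:
  assumes "lam \<in> \<Lambda>" "mu \<in> \<Lambda>" "mirror lam mu"
  shows "(\<zeta> mu)\<^sup>2 = cnj ((\<zeta> lam)\<^sup>2)"
proof -
  have "(\<zeta> mu)\<^sup>2 * (\<Phi> mu 0)\<^sup>2 = (\<Phi> mu T)\<^sup>2"
    using square_multiplier[OF assms(2)] unfolding multiplier_def by (metis add_0)
  also have "\<dots> = cnj ((\<Phi> lam T)\<^sup>2)" using assms(3) by (simp add: mirror_def)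
  also have "\<dots> = cnj ((\<zeta> lam)\<^sup>2) * cnj ((\<Phi> lam 0)\<^sup>2)"
    using square_multiplier[OF assms(1)] unfolding multiplier_def by (metis add_0 complex_cnj_mult)
  also have "cnj ((\<Phi> lam 0)\<^sup>2) = (\<Phi> mu 0)\<^sup>2" using assms(3) by (simp add: mirror_def)
  finally show ?thesis using solution_nonzero[OF assms(2), of 0] by simp
qed

lemma mirror_irrefl: "lam \<in> \<Lambda> \<Longrightarrow> \<not> mirror lam lam"
proof
  assume "lam \<in> \<Lambda>" "mirror lam lam"
  from mirror_multiplier[OF this(1,1,2)] have "Im ((\<zeta> lam)\<^sup>2) = Im (cnj ((\<zeta> lam)\<^sup>2))" by metis
  then show False using nonreal[OF \<open>lam \<in> \<Lambda>\<close>] by (simp del: complex_cnj_power)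
qed

lemma mirror_unique:
  assumes "lam \<in> \<Lambda>" "mu \<in> \<Lambda>" "nu \<in> \<Lambda>" "mirror lam mu" "mirror lam nu"
  shows "mu = nu"
proof -
  have "Re ((\<zeta> mu)\<^sup>2) = Re ((\<zeta> lam)\<^sup>2)" "Re ((\<zeta> nu)\<^sup>2) = Re ((\<zeta> lam)\<^sup>2)"
    using mirror_multiplier assms by (simp_all del: complex_cnj_power)
  then show ?thesis using cluster[of lam mu nu] assms mirror_irrefl by auto
qed

lemma mirror_modulus: "mirror lam mu \<Longrightarrow> cmod (\<Phi> mu n) = cmod (\<Phi> lam n)"
proof -
  assume "mirror lam mu"
  then have "cmod ((\<Phi> mu n)\<^sup>2) = cmod ((\<Phi> lam n)\<^sup>2)"
    by (simp add: mirror_def del: complex_cnj_power)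
  then show ?thesis by (simp add: norm_power)
qed

text \<open>
  Proportional squares mean equality up to signs depending on the site, by the normalisation of the initial value
  and of the Wronskian. If \<open>\<psi>\<close> is the conjugate of \<open>\<Phi> mu\<close>, this is the mirror relation. If \<open>\<psi>\<close> is \<open>\<Phi> mu\<close> itself, equality
  of the Wronskians forces all signs to agree, and a common solution belongs to one energy only.
\<close>

lemma proportional_squares:
  assumes lam: "lam \<in> \<Lambda>" and mu: "mu \<in> \<Lambda>" and ne: "lam \<noteq> mu"
    and \<psi>: "\<psi> = \<Phi> mu \<or> \<psi> = (\<lambda>n. cnj (\<Phi> mu n))"
    and proportional: "\<And>n. (\<psi> 0)\<^sup>2 * (\<Phi> lam n)\<^sup>2 = (\<psi> n)\<^sup>2 * (\<Phi> lam 0)\<^sup>2"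
  shows "mirror lam mu"
proof -
  define p s where "p = Re (\<Phi> lam 0)" and "s = Re (\<Phi> mu 0)"
  have p: "\<Phi> lam 0 = p" "p > 0" and s: "\<Phi> mu 0 = s" "s > 0"
    using initial_value lam mu by (auto simp: p_def s_def)
  have \<psi>0: "\<psi> 0 = s" using \<psi> s by auto
  have pm: "\<psi> n * p = s * \<Phi> lam n \<or> \<psi> n * p = - (s * \<Phi> lam n)" for n
  proof -
    have "(\<psi> n * p)\<^sup>2 = (s * \<Phi> lam n)\<^sup>2"
      using proportional[of n] unfolding \<psi>0 p(1) by (simp add: power_mult_distrib)
    then show ?thesis by (simp add: power2_eq_iff)
  qed
  have W: "\<alpha> 0 * (Im (\<Phi> lam 1) * p) = 1" "\<alpha> 0 * (Im (\<Phi> mu 1) * s) = 1"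
    using wronskian[OF lam, of 0] wronskian[OF mu, of 0] p s by simp_all
  have abs: "\<bar>Im (\<psi> 1)\<bar> = \<bar>Im (\<Phi> mu 1)\<bar>" using \<psi> by auto
  have "\<bar>Im (\<psi> 1)\<bar> * p = s * \<bar>Im (\<Phi> lam 1)\<bar>"
  proof -
    have "Im (\<psi> 1 * p) = Im (s * \<Phi> lam 1) \<or> Im (\<psi> 1 * p) = - Im (s * \<Phi> lam 1)"
      using pm[of 1] by (metis uminus_complex.sel(2))
    then have "\<bar>Im (\<psi> 1) * p\<bar> = \<bar>s * Im (\<Phi> lam 1)\<bar>" by auto
    then show ?thesis using p(2) s(2) by (simp add: abs_mult)
  qed
  moreover have "\<bar>Im (\<Phi> lam 1)\<bar> = 1 / (\<alpha> 0 * p)" "\<bar>Im (\<Phi> mu 1)\<bar> = 1 / (\<alpha> 0 * s)"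
  proof -
    have "Im (\<Phi> lam 1) = 1 / (\<alpha> 0 * p)" "Im (\<Phi> mu 1) = 1 / (\<alpha> 0 * s)"
      using W \<alpha>_pos[of 0] p s by (simp_all add: field_simps)
    then show "\<bar>Im (\<Phi> lam 1)\<bar> = 1 / (\<alpha> 0 * p)" "\<bar>Im (\<Phi> mu 1)\<bar> = 1 / (\<alpha> 0 * s)"
      using \<alpha>_pos[of 0] p s by simp_all
  qed
  ultimately have "p / (\<alpha> 0 * s) = s / (\<alpha> 0 * p)" using abs by (simp add: mult.commute)
  then have "p * p = s * s" using \<alpha>_pos[of 0] p s by (simp add: divide_simps)
  then have ps: "p = s" using p s by (metis abs_of_pos power2_abs power2_eq_imp_eq power2_eq_square less_imp_le)
  then have pm': "\<psi> n = \<Phi> lam n \<or> \<psi> n = - \<Phi> lam n" for n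
  proof -
    have p0: "complex_of_real p \<noteq> 0" using p by simp
    have "\<psi> n * p = \<Phi> lam n * p \<or> \<psi> n * p = (- \<Phi> lam n) * p"
      using pm[of n] ps by (simp add: mult.commute)
    then show ?thesis using mult_right_cancel[OF p0] by blast
  qed
  from \<psi> show ?thesis
  proof
    assume "\<psi> = (\<lambda>n. cnj (\<Phi> mu n))"
    then have "cnj ((\<Phi> mu n)\<^sup>2) = (\<Phi> lam n)\<^sup>2" for n using pm'[of n] by auto
    then show ?thesis unfolding mirror_def by (metis complex_cnj_cnj)
  next
    \<comment> \<open>equal Wronskians leave no room for a sign, so two energies would share one solution\<close>
    assume \<psi>: "\<psi> = \<Phi> mu"
    have eq: "\<Phi> mu n = \<Phi> lam n" for n
    proof (induction n)
      case (Suc n)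
      show ?case
      proof (rule ccontr)
        assume "\<Phi> mu (Suc n) \<noteq> \<Phi> lam (Suc n)"
        then have "\<Phi> mu (Suc n) = - \<Phi> lam (Suc n)" using pm'[of "Suc n"] \<psi> by auto
        then have "\<Phi> mu (Suc n) * cnj (\<Phi> mu n) = - (\<Phi> lam (Suc n) * cnj (\<Phi> lam n))"
          using Suc by simp
        then have "\<alpha> n * Im (\<Phi> mu (Suc n) * cnj (\<Phi> mu n)) = - (\<alpha> n * Im (\<Phi> lam (Suc n) * cnj (\<Phi> lam n)))"
          by (simp only: uminus_complex.sel mult_minus_right)
        then show False using wronskian[OF lam, of n] wronskian[OF mu, of n] by linarith
      qed
    qed (use p s ps in simp)
    have "lam * \<Phi> lam (Suc 0) = mu * \<Phi> lam (Suc 0)"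
      using recurrence[OF lam, of 0] recurrence[OF mu, of 0] eq by simp
    then show ?thesis using solution_nonzero[OF lam] ne by simp
  qed
qed

text \<open>
  First a functional on one or two sites and their translates by \<open>T\<close> reads off \<open>(\<Phi> lam)\<^sup>2\<close> and ignores the one energy that may share its
  frequency; then the operators of \<open>sampling_annihilate\<close> remove all other frequencies. The number \<open>1\<close> belongs to
  the set of removed frequencies so that sequences of period \<open>T\<close>, such as \<open>\<bar>\<Phi> lam\<bar>\<^sup>2\<close>, are ignored as well.
\<close>

lemma dual_functional:
  assumes S: "finite S" "S \<subseteq> \<Lambda>" and lam: "lam \<in> S"
  shows "\<exists>F. sampling F \<and> F (\<lambda>n. (\<Phi> lam n)\<^sup>2) = t \<and> (\<forall>f :: nat \<Rightarrow> complex. multiplier T 1 f \<longrightarrow> F f = 0) \<and>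
    (\<forall>mu\<in>S. mu \<noteq> lam \<and> \<not> mirror lam mu \<longrightarrow> F (\<lambda>n. (\<Phi> mu n)\<^sup>2) = 0)"
proof -
  let ?z = "\<lambda>mu. (\<zeta> mu)\<^sup>2"
  let ?f = "\<lambda>mu n. (\<Phi> mu n)\<^sup>2"
  have lam': "lam \<in> \<Lambda>" using S lam by auto
  have unit: "cmod (?z mu) = 1" if "mu \<in> S" for mu using that S unimodular by (auto simp: norm_power)
  have quad: "1 - 2 * complex_of_real k * z + z\<^sup>2 = 2 * z * (Re z - k)" if "cmod z = 1" for k z
  proof -
    have "z * cnj z = 1" using that by (simp add: complex_norm_square[symmetric])
    then have "1 + z\<^sup>2 = z * (z + cnj z)" by (simp add: algebra_simps power2_eq_square)
    then show ?thesis by (simp add: complex_add_cnj algebra_simps)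
  qed
  \<comment> \<open>frequencies to be removed: those of period \<open>T\<close> and those of all energies outside the cluster of \<open>lam\<close>\<close>
  define B where "B = insert 1 ((\<lambda>mu. Re (?z mu)) ` S - {Re (?z lam)})"
  define P where "P = (\<Prod>k\<in>B. 1 - 2 * complex_of_real k * ?z lam + (?z lam)\<^sup>2)"
  have "finite B" using S by (simp add: B_def)
  have "Re (?z lam) \<noteq> 1"
  proof
    assume "Re (?z lam) = 1"
    then have "(Im (?z lam))\<^sup>2 = 0" using unit[OF lam] cmod_power2[of "?z lam"] by simp
    then show False using nonreal[OF lam'] by simp
  qed
  then have "k \<noteq> Re (?z lam)" if "k \<in> B" for k using that by (auto simp: B_def)
  then have "P \<noteq> 0" unfolding P_def using quad[OF unit[OF lam]] \<open>finite B\<close> unit[OF lam]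
    by (auto simp: prod_zero_iff)
  have base: "\<exists>F. sampling F \<and> F (?f lam) = t / P \<and>
      (\<forall>mu\<in>S. Re (?z mu) = Re (?z lam) \<and> mu \<noteq> lam \<and> \<not> mirror lam mu \<longrightarrow> F (?f mu) = 0)"
  proof (cases "\<exists>mu\<in>S. Re (?z mu) = Re (?z lam) \<and> mu \<noteq> lam \<and> \<not> mirror lam mu")
    case False
    obtain F where "sampling F"
      "\<And>f. multiplier T (?z lam) f \<Longrightarrow> F f = t / P / (\<Phi> lam 0)\<^sup>2 * f 0"
      using sampling_point_complex[OF nonreal[OF lam']] by meson
    then have "F (?f lam) = t / P"
      using square_multiplier[OF lam'] solution_nonzero[OF lam', of 0] by simp
    then show ?thesis using False \<open>sampling F\<close> by blast
  next
    case True
    then obtain mu where mu: "mu \<in> S" "Re (?z mu) = Re (?z lam)" "mu \<noteq> lam" "\<not> mirror lam mu"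
      by blast
    then have mu': "mu \<in> \<Lambda>" using S by auto
    have only: "nu = mu" if "nu \<in> S" "Re (?z nu) = Re (?z lam)" "nu \<noteq> lam" for nu
      using cluster[of lam mu nu] that mu lam' mu' S by auto
    \<comment> \<open>conjugate the solution of the competing energy if that is needed to give both squares the same multiplier\<close>
    define \<psi> where "\<psi> = (if ?z mu = ?z lam then \<Phi> mu else (\<lambda>n. cnj (\<Phi> mu n)))"
    have "?z mu = ?z lam \<or> ?z mu = cnj (?z lam)"
    proof -
      have "(Im (?z mu))\<^sup>2 = (Im (?z lam))\<^sup>2"
        using unit[OF mu(1)] unit[OF lam] mu(2) cmod_power2[of "?z mu"] cmod_power2[of "?z lam"] by simp
      then show ?thesis using mu(2) by (auto simp: complex_eq_iff power2_eq_iff simp del: complex_cnj_power)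
    qed
    then have m\<psi>: "multiplier T (?z lam) (\<lambda>n. (\<psi> n)\<^sup>2)"
      using square_multiplier[OF mu'] by (auto simp: multiplier_def \<psi>_def simp flip: complex_cnj_power)
    obtain n where n: "(\<psi> 0)\<^sup>2 * (\<Phi> lam n)\<^sup>2 \<noteq> (\<psi> n)\<^sup>2 * (\<Phi> lam 0)\<^sup>2"
    proof -
      have "\<psi> = \<Phi> mu \<or> \<psi> = (\<lambda>n. cnj (\<Phi> mu n))" by (simp add: \<psi>_def)
      from proportional_squares[OF lam' mu' not_sym[OF mu(3)] this] mu(4)
      have "\<not> (\<forall>n. (\<psi> 0)\<^sup>2 * (\<Phi> lam n)\<^sup>2 = (\<psi> n)\<^sup>2 * (\<Phi> lam 0)\<^sup>2)" by metis
      then show ?thesis using that by metis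
    qed
    define D where "D = (\<psi> 0)\<^sup>2 * (\<Phi> lam n)\<^sup>2 - (\<psi> n)\<^sup>2 * (\<Phi> lam 0)\<^sup>2"
    have D: "D \<noteq> 0" using n by (simp add: D_def)
    define k where "k = t / P / D"
    obtain F where F: "sampling F"
      "\<And>f. multiplier T (?z lam) f \<Longrightarrow> F f = k * (\<psi> 0)\<^sup>2 * f n"
      using sampling_point_complex[OF nonreal[OF lam']] by meson
    obtain G where G: "sampling G"
      "\<And>f. multiplier T (?z lam) f \<Longrightarrow> G f = - (k * (\<psi> n)\<^sup>2) * f 0"
      using sampling_point_complex[OF nonreal[OF lam']] by meson
    let ?H = "\<lambda>f. F f + G f"
    have H: "sampling ?H" using F G by (intro sampling.add)
    have "?H (?f lam) = k * D"
      using F(2)[OF square_multiplier[OF lam']] G(2)[OF square_multiplier[OF lam']]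
      by (simp add: D_def algebra_simps)
    then have 1: "?H (?f lam) = t / P" using D by (simp add: k_def)
    have 2: "?H (\<lambda>n. (\<psi> n)\<^sup>2) = 0" using F(2)[OF m\<psi>] G(2)[OF m\<psi>] by simp
    have "?H (?f mu) = 0"
    proof (cases "?z mu = ?z lam")
      case False
      then have "?f mu = (\<lambda>n. cnj ((\<psi> n)\<^sup>2))" by (simp add: \<psi>_def)
      then show ?thesis using sampling_cnj[OF H, of "\<lambda>n. (\<psi> n)\<^sup>2"] 2 by simp
    qed (use 2 in \<open>simp add: \<psi>_def\<close>)
    then show ?thesis using H 1 only by blast
  qed
  then obtain F where F: "sampling F" "F (?f lam) = t / P"
    "\<And>mu. \<lbrakk>mu \<in> S; Re (?z mu) = Re (?z lam); mu \<noteq> lam; \<not> mirror lam mu\<rbrakk> \<Longrightarrow> F (?f mu) = 0" by blast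
  obtain G where G: "sampling G" "\<And>f z. multiplier T z f \<Longrightarrow>
    G f = (\<Prod>k\<in>B. 1 - 2 * complex_of_real k * z + z\<^sup>2) * F f"
    using sampling_annihilate[OF F(1) \<open>finite B\<close>] by blast
  have kill: "G f = 0" if "multiplier T z f" "cmod z = 1" "Re z \<in> B" for f z
    using G(2)[OF that(1)] quad[OF that(2)] \<open>finite B\<close> that(3) by (auto simp: prod_zero_iff)
  show ?thesis
  proof (intro exI[of _ G] conjI allI impI ballI)
    show "sampling G" by fact
    show "G (?f lam) = t" using G(2)[OF square_multiplier[OF lam']] F(2) \<open>P \<noteq> 0\<close> by (simp add: P_def)
    show "G f = 0" if "multiplier T 1 f" for f using kill[OF that] by (simp add: B_def)
    show "G (?f mu) = 0" if "mu \<in> S" "mu \<noteq> lam \<and> \<not> mirror lam mu" for mu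
    proof (cases "Re (?z mu) = Re (?z lam)")
      case True
      then show ?thesis using G(2)[OF square_multiplier] F(3) that S by auto
    next
      case False
      then have "Re (?z mu) \<in> B" using that(1) by (auto simp: B_def)
      moreover have "multiplier T (?z mu) (?f mu)" using square_multiplier that S by blast
      ultimately show ?thesis using kill unit[OF that(1)] by blast
    qed
  qed
qed

text \<open>
  The moments of \<open>x\<close> against all \<open>(\<Phi> lam)\<^sup>2\<close> can be prescribed, subject to the one constraint that mirror pairs
  impose, with weights bounded linearly in the prescribed values. They are the combination of two dual functionals
  (for the values \<open>1\<close> and \<open>\<i>\<close>) of every energy, where a mirror pair is represented by its smaller member.
\<close>

lemma prescribed_moments:
  assumes S: "finite S" "S \<subseteq> \<Lambda>"
  obtains L :: nat and B :: real where "B \<ge> 0"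
    and "\<And>t \<tau>. \<lbrakk>\<And>lam. lam \<in> S \<Longrightarrow> cmod (t lam) \<le> \<tau>;
        \<And>lam mu. \<lbrakk>lam \<in> S; mu \<in> S; mirror lam mu\<rbrakk> \<Longrightarrow> t mu = cnj (t lam)\<rbrakk> \<Longrightarrow>
      \<exists>x :: nat \<Rightarrow> real. (\<forall>n. \<bar>x n\<bar> \<le> B * \<tau>) \<and>
        (\<forall>N\<ge>L. (\<forall>lam\<in>S. (\<Sum>n<N. x n * (\<Phi> lam n)\<^sup>2) = t lam) \<and>
          (\<forall>f :: nat \<Rightarrow> complex. multiplier T 1 f \<longrightarrow> (\<Sum>n<N. x n * f n) = 0))"
proof -
  define dual where "dual lam z L x \<longleftrightarrow> (\<forall>n\<ge>L. x n = 0) \<and>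
      (\<forall>N\<ge>L. (\<Sum>n<N. complex_of_real (x n) * (\<Phi> lam n)\<^sup>2) = z \<and>
        (\<forall>f :: nat \<Rightarrow> complex. multiplier T 1 f \<longrightarrow> (\<Sum>n<N. complex_of_real (x n) * f n) = 0) \<and>
        (\<forall>mu\<in>S. mu \<noteq> lam \<and> \<not> mirror lam mu \<longrightarrow> (\<Sum>n<N. complex_of_real (x n) * (\<Phi> mu n)\<^sup>2) = 0))"
    for lam z and L :: nat and x :: "nat \<Rightarrow> real"
  have ex: "\<exists>L x. dual lam z L x" if lS: "lam \<in> S" for lam z
  proof -
    obtain F where F: "sampling F" "F (\<lambda>n. (\<Phi> lam n)\<^sup>2) = z" "\<And>f. multiplier T 1 f \<Longrightarrow> F f = 0"
      "\<And>mu. mu \<in> S \<Longrightarrow> mu \<noteq> lam \<and> \<not> mirror lam mu \<Longrightarrow> F (\<lambda>n. (\<Phi> mu n)\<^sup>2) = 0"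
      using dual_functional[OF S lS, of z] by blast
    obtain L x where x: "\<And>n. n \<ge> L \<Longrightarrow> x n = 0"
      "\<And>N f. N \<ge> L \<Longrightarrow> F f = (\<Sum>n<N. complex_of_real (x n) * f n)"
      using sampling_weights[OF F(1)] by metis
    then have "dual lam z L x" unfolding dual_def using F by (auto simp flip: x(2))
    then show ?thesis by blast
  qed
  obtain L1 x1 where 1: "\<And>lam. lam \<in> S \<Longrightarrow> dual lam 1 (L1 lam) (x1 lam)" using ex[of _ 1] by metis
  obtain L2 x2 where 2: "\<And>lam. lam \<in> S \<Longrightarrow> dual lam \<i> (L2 lam) (x2 lam)" using ex[of _ \<i>] by metis
  define L where "L = (\<Sum>lam\<in>S. L1 lam + L2 lam)"
  have L: "L1 lam \<le> L" "L2 lam \<le> L" if "lam \<in> S" for lam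
    using member_le_sum[of lam S "\<lambda>lam. L1 lam + L2 lam"] that S by (auto simp: L_def)
  define \<beta> where "\<beta> lam = (\<Sum>n<L. \<bar>x1 lam n\<bar>) + (\<Sum>n<L. \<bar>x2 lam n\<bar>)" for lam
  have \<beta>: "\<bar>x1 lam n\<bar> + \<bar>x2 lam n\<bar> \<le> \<beta> lam" if "lam \<in> S" for lam n
  proof (cases "n < L")
    case True
    then show ?thesis
      using member_le_sum[of n "{..<L}" "\<lambda>n. \<bar>x1 lam n\<bar>"] member_le_sum[of n "{..<L}" "\<lambda>n. \<bar>x2 lam n\<bar>"]
      by (simp add: \<beta>_def)
  next
    case False
    then have "x1 lam n = 0" "x2 lam n = 0" using 1[OF that] 2[OF that] L[OF that] by (auto simp: dual_def)
    then show ?thesis by (simp add: \<beta>_def sum_nonneg)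
  qed
  \<comment> \<open>one representative of each mirror pair\<close>
  define R where "R = {lam\<in>S. \<forall>mu\<in>S. mirror lam mu \<longrightarrow> lam < mu}"
  have R: "R \<subseteq> S" "finite R" using S by (auto simp: R_def)
  define B where "B = (\<Sum>lam\<in>S. \<beta> lam)"
  have "B \<ge> 0" unfolding B_def \<beta>_def by (intro sum_nonneg add_nonneg_nonneg) auto
  moreover have "\<exists>x :: nat \<Rightarrow> real. (\<forall>n. \<bar>x n\<bar> \<le> B * \<tau>) \<and>
        (\<forall>N\<ge>L. (\<forall>lam\<in>S. (\<Sum>n<N. x n * (\<Phi> lam n)\<^sup>2) = t lam) \<and>
          (\<forall>f :: nat \<Rightarrow> complex. multiplier T 1 f \<longrightarrow> (\<Sum>n<N. x n * f n) = 0))"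
    if t: "\<And>lam. lam \<in> S \<Longrightarrow> cmod (t lam) \<le> \<tau>"
      "\<And>lam mu. \<lbrakk>lam \<in> S; mu \<in> S; mirror lam mu\<rbrakk> \<Longrightarrow> t mu = cnj (t lam)" for t \<tau>
  proof -
    define x where "x n = (\<Sum>lam\<in>R. Re (t lam) * x1 lam n + Im (t lam) * x2 lam n)" for n
    have bound: "\<bar>x n\<bar> \<le> B * \<tau>" for n
    proof -
      have "\<bar>x n\<bar> \<le> (\<Sum>lam\<in>R. \<bar>Re (t lam) * x1 lam n + Im (t lam) * x2 lam n\<bar>)"
        unfolding x_def by (rule sum_abs)
      also have "\<dots> \<le> (\<Sum>lam\<in>R. \<beta> lam * \<tau>)"
      proof (rule sum_mono)
        fix lam assume "lam \<in> R"
        then have lS: "lam \<in> S" using R by auto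
        have \<tau>: "\<bar>Re (t lam)\<bar> \<le> \<tau>" "\<bar>Im (t lam)\<bar> \<le> \<tau>"
          using t(1)[OF lS] abs_Re_le_cmod[of "t lam"] abs_Im_le_cmod[of "t lam"] by linarith+
        have "\<bar>Re (t lam) * x1 lam n + Im (t lam) * x2 lam n\<bar>
            \<le> \<bar>Re (t lam)\<bar> * \<bar>x1 lam n\<bar> + \<bar>Im (t lam)\<bar> * \<bar>x2 lam n\<bar>"
          by (metis abs_mult abs_triangle_ineq)
        also have "\<dots> \<le> \<tau> * \<bar>x1 lam n\<bar> + \<tau> * \<bar>x2 lam n\<bar>"
          using \<tau> by (intro add_mono mult_right_mono) auto
        also have "\<dots> = (\<bar>x1 lam n\<bar> + \<bar>x2 lam n\<bar>) * \<tau>" by (simp add: algebra_simps)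
        also have "\<dots> \<le> \<beta> lam * \<tau>"
          using \<beta>[OF lS] \<tau> by (intro mult_right_mono) auto
        finally show "\<bar>Re (t lam) * x1 lam n + Im (t lam) * x2 lam n\<bar> \<le> \<beta> lam * \<tau>" .
      qed
      also have "\<dots> \<le> (\<Sum>lam\<in>S. \<beta> lam * \<tau>)"
      proof (rule sum_mono2)
        fix lam assume "lam \<in> S - R"
        then have "0 \<le> \<tau>" using t(1)[of lam] norm_ge_zero[of "t lam"] by (metis Diff_iff order_trans)
        then show "0 \<le> \<beta> lam * \<tau>" by (simp add: \<beta>_def sum_nonneg)
      qed (use R S in auto)
      finally show ?thesis by (simp add: B_def sum_distrib_right)
    qed
    have lin: "(\<Sum>n<N. complex_of_real (x n) * f n) = (\<Sum>lam\<in>R. Re (t lam) * (\<Sum>n<N. x1 lam n * f n)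
        + Im (t lam) * (\<Sum>n<N. x2 lam n * f n))" for N and f :: "nat \<Rightarrow> complex"
    proof -
      have "(\<Sum>n<N. complex_of_real (x n) * f n) = (\<Sum>n<N. \<Sum>lam\<in>R. Re (t lam) * (x1 lam n * f n)
          + Im (t lam) * (x2 lam n * f n))"
        by (simp only: x_def of_real_sum sum_distrib_right) (simp add: algebra_simps)
      also have "\<dots> = (\<Sum>lam\<in>R. \<Sum>n<N. Re (t lam) * (x1 lam n * f n) + Im (t lam) * (x2 lam n * f n))"
        by (rule sum.swap)
      finally show ?thesis by (simp add: sum.distrib sum_distrib_left)
    qed
    have rep: "(\<Sum>n<N. complex_of_real (x n) * (\<Phi> nu n)\<^sup>2) = t nu" if "nu \<in> R" "N \<ge> L" for nu N
    proof -
      have nu: "nu \<in> S" using that R by auto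
      have "(\<Sum>n<N. complex_of_real (x n) * (\<Phi> nu n)\<^sup>2) = (\<Sum>lam\<in>R. if lam = nu then t nu else 0)"
        unfolding lin
      proof (intro sum.cong refl)
        fix lam assume "lam \<in> R"
        then have lS: "lam \<in> S" using R by auto
        have N: "N \<ge> L1 lam" "N \<ge> L2 lam" using L[OF lS] that by auto
        show "Re (t lam) * (\<Sum>n<N. x1 lam n * (\<Phi> nu n)\<^sup>2) + Im (t lam) * (\<Sum>n<N. x2 lam n * (\<Phi> nu n)\<^sup>2)
            = (if lam = nu then t nu else 0)"
        proof (cases "lam = nu")
          case True
          then have "(\<Sum>n<N. x1 lam n * (\<Phi> nu n)\<^sup>2) = 1" "(\<Sum>n<N. x2 lam n * (\<Phi> nu n)\<^sup>2) = \<i>"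
            using 1[OF lS] 2[OF lS] N by (auto simp: dual_def)
          then show ?thesis using True by (simp add: complex_eq_iff)
        next
          case False
          moreover have "\<not> mirror lam nu"
            using \<open>lam \<in> R\<close> that(1) mirror_sym[of lam nu] lS nu unfolding R_def by fastforce
          ultimately have "(\<Sum>n<N. x1 lam n * (\<Phi> nu n)\<^sup>2) = 0" "(\<Sum>n<N. x2 lam n * (\<Phi> nu n)\<^sup>2) = 0"
            using 1[OF lS] 2[OF lS] N nu by (auto simp: dual_def)
          then show ?thesis using False by simp
        qed
      qed
      then show ?thesis using that R by simp
    qed
    have all: "(\<Sum>n<N. complex_of_real (x n) * (\<Phi> nu n)\<^sup>2) = t nu" if nu: "nu \<in> S" "N \<ge> L" for nu N
    proof (cases "nu \<in> R")
      case False
      then obtain lam where lam: "lam \<in> S" "mirror nu lam" "lam \<le> nu"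
        using nu by (auto simp: R_def)
      have "lam \<noteq> nu" using lam mirror_irrefl S by auto
      have "lam \<in> R"
      proof -
        have "mu = nu" if "mu \<in> S" "mirror lam mu" for mu
          using mirror_unique[of lam mu nu] that lam mirror_sym[of nu lam] \<open>nu \<in> S\<close> S by auto
        then show ?thesis using lam \<open>lam \<noteq> nu\<close> by (auto simp: R_def)
      qed
      have "(\<Sum>n<N. complex_of_real (x n) * (\<Phi> nu n)\<^sup>2) = cnj (\<Sum>n<N. complex_of_real (x n) * (\<Phi> lam n)\<^sup>2)"
        using mirror_sym[OF lam(2)] by (simp add: mirror_def)
      also have "\<dots> = t nu" using rep[OF \<open>lam \<in> R\<close> nu(2)] t(2)[of lam nu] lam nu mirror_sym by simp
      finally show ?thesis .
    qed (use rep that in blast)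
    have zero: "(\<Sum>n<N. complex_of_real (x n) * f n) = 0" if "multiplier T 1 f" "N \<ge> L" for f N
      unfolding lin
    proof (intro sum.neutral ballI)
      fix lam assume "lam \<in> R"
      then have lS: "lam \<in> S" using R by auto
      then have "(\<Sum>n<N. x1 lam n * f n) = 0" "(\<Sum>n<N. x2 lam n * f n) = 0"
        using 1[OF lS] 2[OF lS] L[OF lS] that by (auto simp: dual_def)
      then show "Re (t lam) * (\<Sum>n<N. x1 lam n * f n) + Im (t lam) * (\<Sum>n<N. x2 lam n * f n) = 0" by simp
    qed
    show ?thesis
      by (intro exI[of _ x] conjI allI impI ballI bound all zero)
  qed
  ultimately show ?thesis by (rule that)
qed

end

section \<open>Amplitudes under a small potential\<close>

text \<open>
  Variation of constants: for a Floquet solution \<open>\<phi>\<close> the increment at \<open>n\<close> leaves \<open>Re (\<phi> n * c)\<close> unchanged, and it changes the next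
  value \<open>Re (\<phi> (Suc n) * c)\<close> by what the potential at \<open>n\<close> requires.
\<close>

primrec amplitude :: "(nat \<Rightarrow> complex) \<Rightarrow> (nat \<Rightarrow> real) \<Rightarrow> complex \<Rightarrow> nat \<Rightarrow> complex" where
  "amplitude \<phi> q c 0 = c"
| "amplitude \<phi> q c (Suc n) = amplitude \<phi> q c n
     + \<i> * complex_of_real (q n * Re (\<phi> n * amplitude \<phi> q c n)) * cnj (\<phi> n)"

lemma amplitude_cong: "(\<And>k. k < n \<Longrightarrow> q k = q' k) \<Longrightarrow> amplitude \<phi> q c n = amplitude \<phi> q' c n"
  by (induction n) auto

lemma amplitude_const: "(\<And>k. s \<le> k \<Longrightarrow> k < s + n \<Longrightarrow> q k = 0) \<Longrightarrow> amplitude \<phi> q c (s + n) = amplitude \<phi> q c s"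
  by (induction n) auto

text \<open>
  The step can be undone: it preserves \<open>Re (\<phi> n * c)\<close>, which determines the increment.
\<close>

lemma amplitude_nonzero: "c \<noteq> 0 \<Longrightarrow> amplitude \<phi> q c n \<noteq> 0"
proof (induction n)
  case (Suc n)
  let ?c = "amplitude \<phi> q c n" and ?u = "Re (\<phi> n * amplitude \<phi> q c n)"
  show ?case
  proof
    assume zero: "amplitude \<phi> q c (Suc n) = 0"
    define k where "k = complex_of_real (q n * ?u)"
    have c: "?c = - (\<i> * k * cnj (\<phi> n))"
      using zero unfolding k_def amplitude.simps(2) by (simp only: add_eq_0_iff2)
    have "\<phi> n * ?c = - (\<i> * k * (\<phi> n * cnj (\<phi> n)))"
      by (subst c) (simp add: algebra_simps)
    then have "?u = Re (- (\<i> * k * complex_of_real ((cmod (\<phi> n))\<^sup>2)))"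
      by (simp only: complex_norm_square)
    then have "?u = 0" by (simp add: k_def)
    then have "k = 0" unfolding k_def by (simp only: mult_zero_right of_real_0)
    then have "?c = 0" using c by simp
    then show False using Suc by simp
  qed
qed simp

text \<open>
  First order perturbation theory on a cell. If every step changes the amplitude by at most the fraction \<open>\<delta>\<close>, then
  replacing the current amplitude by the initial one in each increment costs \<open>O(\<delta>\<^sup>2)\<close> in total.
\<close>

lemma amplitude_variation:
  assumes \<delta>: "0 \<le> \<delta>" "\<delta> \<le> 1"
    and small: "\<And>n. n < L \<Longrightarrow> \<bar>q (s + n)\<bar> * (cmod (\<phi> (s + n)))\<^sup>2 \<le> \<delta>"
    and m: "m \<le> L"
  shows "cmod (amplitude \<phi> q c (s + m) - amplitude \<phi> q c s) \<le> (2 ^ m - 1) * \<delta> * cmod (amplitude \<phi> q c s)"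
    and "cmod (amplitude \<phi> q c (s + m) - amplitude \<phi> q c s - (\<Sum>n<m. \<i> *
          complex_of_real (q (s + n) * Re (\<phi> (s + n) * amplitude \<phi> q c s)) * cnj (\<phi> (s + n))))
      \<le> m * (2 ^ L * \<delta>\<^sup>2 * cmod (amplitude \<phi> q c s))"
proof -
  let ?c = "amplitude \<phi> q c s"
  let ?E = "\<lambda>n z. \<i> * complex_of_real (q (s + n) * Re (\<phi> (s + n) * z)) * cnj (\<phi> (s + n))"
  have E: "cmod (?E n z) \<le> \<delta> * cmod z" if "n < L" for n z
  proof -
    have "cmod (?E n z) = \<bar>q (s + n)\<bar> * \<bar>Re (\<phi> (s + n) * z)\<bar> * cmod (\<phi> (s + n))"
      by (simp only: norm_mult norm_of_real abs_mult) simp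
    also have "\<dots> \<le> \<bar>q (s + n)\<bar> * (cmod (\<phi> (s + n)) * cmod z) * cmod (\<phi> (s + n))"
      using abs_Re_le_cmod[of "\<phi> (s + n) * z"] by (intro mult_right_mono mult_left_mono) (auto simp: norm_mult)
    also have "\<dots> = (\<bar>q (s + n)\<bar> * (cmod (\<phi> (s + n)))\<^sup>2) * cmod z" by (simp add: power2_eq_square)
    also have "\<dots> \<le> \<delta> * cmod z" using small[OF that] by (intro mult_right_mono) auto
    finally show ?thesis .
  qed
  have 1: "cmod (amplitude \<phi> q c (s + m) - ?c) \<le> (2 ^ m - 1) * \<delta> * cmod ?c" if "m \<le> L" for m
    using that
  proof (induction m)
    case (Suc m)
    let ?d = "amplitude \<phi> q c (s + m)"
    have IH: "cmod (?d - ?c) \<le> (2 ^ m - 1) * \<delta> * cmod ?c" using Suc by simp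
    have pow: "(1 :: real) \<le> 2 ^ m" by simp
    have "(2 ^ m - 1) * \<delta> * cmod ?c \<le> (2 ^ m - 1) * 1 * cmod ?c"
      using \<delta> pow by (intro mult_right_mono mult_left_mono) auto
    then have "cmod ?d \<le> 2 ^ m * cmod ?c"
      using IH norm_triangle_ineq[of "?d - ?c" ?c] by (simp add: algebra_simps)
    then have "\<delta> * cmod ?d \<le> \<delta> * (2 ^ m * cmod ?c)" using \<delta> by (intro mult_left_mono)
    moreover have "cmod (amplitude \<phi> q c (s + Suc m) - ?c) \<le> cmod (?d - ?c) + cmod (?E m ?d)"
      using norm_triangle_ineq[of "?d - ?c" "?E m ?d"] by (simp add: algebra_simps)
    ultimately show ?case using IH E[of m ?d] Suc.prems by (simp add: algebra_simps)
  qed simp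
  show "cmod (amplitude \<phi> q c (s + m) - ?c) \<le> (2 ^ m - 1) * \<delta> * cmod ?c" by (rule 1[OF m])
  show "cmod (amplitude \<phi> q c (s + m) - ?c - (\<Sum>n<m. ?E n ?c)) \<le> m * (2 ^ L * \<delta>\<^sup>2 * cmod ?c)"
    using m
  proof (induction m)
    case (Suc m)
    let ?d = "amplitude \<phi> q c (s + m)"
    have "(2 ^ m - 1) * \<delta> * cmod ?c \<le> 2 ^ L * \<delta> * cmod ?c"
    proof (intro mult_right_mono)
      have "(2 :: real) ^ m \<le> 2 ^ L" using Suc.prems by (intro power_increasing) auto
      then show "(2 :: real) ^ m - 1 \<le> 2 ^ L" by linarith
    qed (use \<delta> in auto)
    then have "cmod (?d - ?c) \<le> 2 ^ L * \<delta> * cmod ?c" using 1[of m] Suc.prems by simp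
    then have "\<delta> * cmod (?d - ?c) \<le> \<delta> * (2 ^ L * \<delta> * cmod ?c)" using \<delta> by (intro mult_left_mono)
    then have last: "cmod (?E m (?d - ?c)) \<le> 2 ^ L * \<delta>\<^sup>2 * cmod ?c"
      using E[of m "?d - ?c"] Suc.prems by (simp add: power2_eq_square algebra_simps)
    have split: "amplitude \<phi> q c (s + Suc m) - ?c - (\<Sum>n<Suc m. ?E n ?c)
        = (?d - ?c - (\<Sum>n<m. ?E n ?c)) + ?E m (?d - ?c)"
      by (simp add: algebra_simps)
    have "cmod (amplitude \<phi> q c (s + Suc m) - ?c - (\<Sum>n<Suc m. ?E n ?c))
        \<le> m * (2 ^ L * \<delta>\<^sup>2 * cmod ?c) + 2 ^ L * \<delta>\<^sup>2 * cmod ?c"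
      unfolding split
      by (rule order_trans[OF norm_triangle_ineq add_mono[OF Suc.IH[OF Suc_leD[OF Suc.prems]] last]])
    then show ?case by (simp add: algebra_simps)
  qed simp
qed

text \<open>
  Insert \<open>Re w = (w + cnj w) / 2\<close> with \<open>w = \<phi> n * c\<close>: the part with \<open>c\<close> sees \<open>\<bar>\<phi>\<bar>\<^sup>2\<close> and only rotates, the part with
  \<open>cnj c\<close> sees the resonant square \<open>\<phi>\<^sup>2\<close>.
\<close>

lemma first_order_effect:
  fixes x :: "nat \<Rightarrow> real" and \<phi> :: "nat \<Rightarrow> complex"
  shows "(\<Sum>n<L. \<i> * complex_of_real (x n * Re (\<phi> n * c)) * cnj (\<phi> n))
    = \<i> / 2 * (complex_of_real (\<Sum>n<L. x n * (cmod (\<phi> n))\<^sup>2) * c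
        + cnj (\<Sum>n<L. complex_of_real (x n) * (\<phi> n)\<^sup>2) * cnj c)"
proof -
  have "\<i> * complex_of_real (x n * Re (\<phi> n * c)) * cnj (\<phi> n)
      = \<i> / 2 * (complex_of_real (x n * (cmod (\<phi> n))\<^sup>2) * c + cnj (complex_of_real (x n) * (\<phi> n)\<^sup>2) * cnj c)" for n
  proof -
    have re: "complex_of_real (Re (\<phi> n * c)) = (\<phi> n * c + cnj (\<phi> n) * cnj c) / 2"
      using complex_add_cnj[of "\<phi> n * c"] by simp
    show ?thesis
      unfolding of_real_mult re complex_norm_square
      by (simp add: power2_eq_square algebra_simps add_divide_distrib)
  qed
  then show ?thesis by (simp add: sum_distrib_left sum_distrib_right sum.distrib algebra_simps)
qed

text \<open>
  The condition on the resonant moment makes the first order effect a multiplication of the amplitude by \<open>- r / s\<close>.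
\<close>

lemma cell_effect:
  fixes s L :: nat and x :: "nat \<Rightarrow> real" and A e r :: real
  assumes s: "s > 0" and x: "\<And>n. n < L \<Longrightarrow> \<bar>x n\<bar> \<le> A" and A: "A \<ge> 0" and e: "\<And>n. (cmod (\<phi> n))\<^sup>2 \<le> e" "e \<ge> 0"
    and q: "\<And>n. n < L \<Longrightarrow> q (s + n) = x n / s"
    and large: "2 ^ L * (e * A) \<le> s"
    and Z: "cnj (\<Sum>n<L. complex_of_real (x n) * (\<phi> (s + n))\<^sup>2) * cnj (amplitude \<phi> q c s)
      = (- complex_of_real (\<Sum>n<L. x n * (cmod (\<phi> (s + n)))\<^sup>2) + 2 * \<i> * complex_of_real r) * amplitude \<phi> q c s"
  shows "m \<le> L \<Longrightarrow> cmod (amplitude \<phi> q c (s + m)) \<le> 2 * cmod (amplitude \<phi> q c s)"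
    and "cmod (amplitude \<phi> q c (s + L) - complex_of_real (1 - r / s) * amplitude \<phi> q c s)
      \<le> (L * 2 ^ L * (e * A)\<^sup>2) / s\<^sup>2 * cmod (amplitude \<phi> q c s)"
proof -
  define \<delta> where "\<delta> = e * A / s"
  let ?c = "amplitude \<phi> q c s"
  have pow: "(1 :: real) \<le> 2 ^ L" by simp
  have eA: "0 \<le> e * A" using e A by simp
  have "e * A \<le> 2 ^ L * (e * A)" using mult_right_mono[OF pow eA] by simp
  then have \<delta>: "0 \<le> \<delta>" "\<delta> \<le> 1" "2 ^ L * \<delta> \<le> 1" using s e(2) A large by (auto simp: \<delta>_def divide_le_eq)
  have small: "\<bar>q (s + n)\<bar> * (cmod (\<phi> (s + n)))\<^sup>2 \<le> \<delta>" if "n < L" for n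
  proof -
    have "\<bar>x n\<bar> * (cmod (\<phi> (s + n)))\<^sup>2 \<le> A * e" using x[OF that] A e by (intro mult_mono) auto
    from divide_right_mono[OF this, of s] show ?thesis using q[OF that] by (simp add: \<delta>_def mult.commute)
  qed
  note var = amplitude_variation[where L = L and \<delta> = \<delta> and q = q and \<phi> = \<phi> and s = s, OF \<delta>(1,2) small]
  show "cmod (amplitude \<phi> q c (s + m)) \<le> 2 * cmod ?c" if "m \<le> L"
  proof -
    have "(2 ^ m - 1) * \<delta> \<le> 2 ^ L * \<delta>"
    proof (intro mult_right_mono)
      have "(2 :: real) ^ m \<le> 2 ^ L" using that by (intro power_increasing) auto
      then show "(2 :: real) ^ m - 1 \<le> 2 ^ L" by linarith
    qed (use \<delta> in auto)
    then have "(2 ^ m - 1) * \<delta> * cmod ?c \<le> 1 * cmod ?c" using \<delta>(3) by (intro mult_right_mono) auto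
    then have "cmod (amplitude \<phi> q c (s + m) - ?c) \<le> cmod ?c" using var(1)[OF _ that, of c] by simp
    then show ?thesis using norm_triangle_ineq[of "amplitude \<phi> q c (s + m) - ?c" ?c] by simp
  qed
  have "(\<Sum>n<L. \<i> * complex_of_real (q (s + n) * Re (\<phi> (s + n) * ?c)) * cnj (\<phi> (s + n)))
      = (\<Sum>n<L. \<i> * complex_of_real (x n * Re (\<phi> (s + n) * ?c)) * cnj (\<phi> (s + n))) / s"
    unfolding sum_divide_distrib using q by (intro sum.cong) auto
  also have "\<dots> = (\<i> / 2 * (2 * \<i> * complex_of_real r * ?c)) / s"
    unfolding first_order_effect[of x "\<lambda>n. \<phi> (s + n)"] Z by (simp add: algebra_simps)
  also have "\<dots> = - complex_of_real (r / s) * ?c" by (simp add: field_simps)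
  finally have "amplitude \<phi> q c (s + L) - complex_of_real (1 - r / s) * ?c = amplitude \<phi> q c (s + L) - ?c
      - (\<Sum>n<L. \<i> * complex_of_real (q (s + n) * Re (\<phi> (s + n) * ?c)) * cnj (\<phi> (s + n)))"
    by (simp add: algebra_simps)
  also have "cmod \<dots> \<le> L * (2 ^ L * \<delta>\<^sup>2 * cmod ?c)" using var(2)[OF _ order_refl] by simp
  also have "\<dots> = (L * 2 ^ L * (e * A)\<^sup>2) / s\<^sup>2 * cmod ?c" by (simp add: \<delta>_def power_divide)
  finally show "cmod (amplitude \<phi> q c (s + L) - complex_of_real (1 - r / s) * ?c)
      \<le> (L * 2 ^ L * (e * A)\<^sup>2) / s\<^sup>2 * cmod ?c" .
qed

text \<open>
  A loss of \<open>2 * L / s\<close> outweighs both the relative growth \<open>L / s\<close> of the position and the second order error.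
\<close>

lemma cell_decay:
  fixes s L r C :: real and c c' :: complex
  assumes s: "s > 0" and L: "L \<ge> 0" and r: "2 * L \<le> r" "r \<le> s" and C: "C / s + C * L / s\<^sup>2 \<le> L"
    and step: "cmod (c' - complex_of_real (1 - r / s) * c) \<le> C / s\<^sup>2 * cmod c"
  shows "(s + L) * cmod c' \<le> s * cmod c"
proof -
  have rs: "0 \<le> 1 - r / s" "1 - r / s \<le> 1 - 2 * L / s" using s r by (auto simp: divide_le_eq divide_right_mono)
  have "cmod c' \<le> cmod (c' - complex_of_real (1 - r / s) * c) + cmod (complex_of_real (1 - r / s) * c)"
    using norm_triangle_ineq[of "c' - complex_of_real (1 - r / s) * c" "complex_of_real (1 - r / s) * c"] by simp
  also have "cmod (complex_of_real (1 - r / s) * c) = (1 - r / s) * cmod c"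
    using rs by (simp only: norm_mult norm_of_real abs_of_nonneg)
  also have "\<dots> \<le> (1 - 2 * L / s) * cmod c" using rs by (intro mult_right_mono) auto
  finally have "cmod c' \<le> (1 - 2 * L / s + C / s\<^sup>2) * cmod c" using step by (simp add: algebra_simps)
  then have "(s + L) * cmod c' \<le> (s + L) * ((1 - 2 * L / s + C / s\<^sup>2) * cmod c)"
    using s L by (intro mult_left_mono) auto
  also have "\<dots> = (s - L + (C / s + C * L / s\<^sup>2) - 2 * L\<^sup>2 / s) * cmod c"
    using s by (simp add: field_simps power2_eq_square)
  also have "\<dots> \<le> s * cmod c"
  proof (rule mult_right_mono)
    have "0 \<le> 2 * L\<^sup>2 / s" using s by simp
    then show "s - L + (C / s + C * L / s\<^sup>2) - 2 * L\<^sup>2 / s \<le> s" using C by linarith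
  qed simp
  finally show ?thesis .
qed

text \<open>
  A common positive factor does not change the phase of \<open>c * d\<close>; relative errors of size \<open>\<eta>\<close> move it by a multiple of \<open>\<eta>\<close>.
\<close>

lemma sector_drift:
  fixes c d c' d' :: complex and l :: "complex \<Rightarrow> real"
  assumes l: "l = Re \<or> l = Im" and nz: "c \<noteq> 0" "d \<noteq> 0" and \<rho>: "1 / 2 \<le> \<rho>" "\<rho> \<le> 1" and \<eta>: "0 \<le> \<eta>" "\<eta> \<le> 1 / 24"
    and c': "cmod (c' - complex_of_real \<rho> * c) \<le> \<eta> * cmod c"
    and d': "cmod (d' - complex_of_real \<rho> * d) \<le> \<eta> * cmod d"
    and m: "0 \<le> m" "l (c * d) \<le> - m * cmod (c * d)"
  shows "l (c' * d') \<le> - (m - 48 * \<eta>) * cmod (c' * d')"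
proof -
  let ?P = "c * d" and ?P' = "c' * d'"
  have P: "cmod ?P > 0" using nz by simp
  have lb: "\<bar>l z\<bar> \<le> cmod z" for z using l abs_Re_le_cmod abs_Im_le_cmod by auto
  have lin: "l (z + complex_of_real k * w) = l z + k * l w" for z w k using l by auto
  have "m * cmod ?P \<le> 1 * cmod ?P" using m(2) lb[of ?P] by simp
  then have m1: "m \<le> 1" using P by simp
  have "?P' - complex_of_real (\<rho>\<^sup>2) * ?P = (c' - \<rho> * c) * (d' - \<rho> * d) + \<rho> * c * (d' - \<rho> * d) + (c' - \<rho> * c) * (\<rho> * d)"
    by (simp add: algebra_simps power2_eq_square)
  also have "cmod \<dots> \<le> cmod ((c' - \<rho> * c) * (d' - \<rho> * d)) + cmod (\<rho> * c * (d' - \<rho> * d)) + cmod ((c' - \<rho> * c) * (\<rho> * d))"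
    by (meson norm_triangle_ineq norm_triangle_mono order_refl order_trans)
  also have "\<dots> \<le> \<eta> * cmod c * (\<eta> * cmod d) + 1 * cmod c * (\<eta> * cmod d) + \<eta> * cmod c * (1 * cmod d)"
    unfolding norm_mult norm_of_real using c' d' \<rho> \<eta> by (intro add_mono mult_mono) auto
  also have "\<dots> = (\<eta> * \<eta> + 2 * \<eta>) * cmod ?P" by (simp add: norm_mult algebra_simps)
  also have "\<dots> \<le> (3 * \<eta>) * cmod ?P"
  proof (rule mult_right_mono)
    have "\<eta> * \<eta> \<le> 1 * \<eta>" using \<eta> by (intro mult_right_mono) auto
    then show "\<eta> * \<eta> + 2 * \<eta> \<le> 3 * \<eta>" by simp
  qed simp
  finally have E: "cmod (?P' - complex_of_real (\<rho>\<^sup>2) * ?P) \<le> 3 * \<eta> * cmod ?P" .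
  define E where "E = ?P' - complex_of_real (\<rho>\<^sup>2) * ?P"
  have P': "?P' = E + complex_of_real (\<rho>\<^sup>2) * ?P" by (simp add: E_def)
  have E3: "cmod E \<le> 3 * \<eta> * cmod ?P" using E by (simp add: E_def)
  have np: "cmod (complex_of_real (\<rho>\<^sup>2) * ?P) = \<rho>\<^sup>2 * cmod ?P"
    by (simp add: norm_mult norm_power power_even_abs)
  have up: "cmod ?P' \<le> 3 * \<eta> * cmod ?P + \<rho>\<^sup>2 * cmod ?P"
    unfolding P' using norm_triangle_ineq[of E "complex_of_real (\<rho>\<^sup>2) * ?P"] E3 np by simp
  have low: "\<rho>\<^sup>2 * cmod ?P \<le> cmod ?P' + 3 * \<eta> * cmod ?P"
    using norm_triangle_ineq4[of ?P' E] np E3 by (simp add: P')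
  have "(1 / 2)\<^sup>2 \<le> \<rho>\<^sup>2" using \<rho> by (intro power_mono) auto
  then have "1 / 4 * cmod ?P \<le> \<rho>\<^sup>2 * cmod ?P" by (intro mult_right_mono) (auto simp: power2_eq_square)
  moreover have "3 * \<eta> * cmod ?P \<le> 1 / 8 * cmod ?P" using \<eta> by (intro mult_right_mono) auto
  ultimately have low8: "cmod ?P \<le> 8 * cmod ?P'" using low by simp
  have "l ?P' = l E + \<rho>\<^sup>2 * l ?P" unfolding P' by (rule lin)
  also have "\<dots> \<le> 3 * \<eta> * cmod ?P + \<rho>\<^sup>2 * (- m * cmod ?P)"
    using lb[of E] E3 m by (intro add_mono mult_left_mono) auto
  also have "\<dots> \<le> 6 * \<eta> * cmod ?P - m * cmod ?P'"
  proof -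
    have "m * cmod ?P' \<le> m * (3 * \<eta> * cmod ?P + \<rho>\<^sup>2 * cmod ?P)" using up m by (intro mult_left_mono)
    moreover have "m * (3 * \<eta> * cmod ?P) \<le> 1 * (3 * \<eta> * cmod ?P)" using m1 \<eta> by (intro mult_right_mono) auto
    ultimately show ?thesis by (simp add: algebra_simps)
  qed
  also have "\<dots> \<le> 48 * \<eta> * cmod ?P' - m * cmod ?P'"
    using mult_left_mono[OF low8, of "6 * \<eta>"] \<eta> by simp
  finally show ?thesis by (simp add: algebra_simps)
qed

section \<open>Weights that shrink finitely many amplitudes\<close>

context resonance_family
begin

text \<open>
  Weights that to first order shrink all amplitudes of a finite family and keep their phases. They are the sum of a positive constant \<open>y\<close>, which
  gives every energy a moment \<open>Y > 0\<close> against \<open>\<bar>\<Phi>\<bar>\<^sup>2\<close>, and of weights that ignore sequences of period \<open>T\<close>, which adjust the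
  resonant moments. For a mirror pair the rate \<open>r\<close> is forced by the phase of \<open>c lam * c mu\<close>; the sector condition bounds it from
  below and above, uniformly in the amplitudes and in the position of the cell, so that a large \<open>y\<close> makes it as large as
  required.
\<close>

lemma steering:
  assumes S: "finite S" "S \<subseteq> \<Lambda>" and m: "m > 0"
  obtains l :: nat and A R :: real where "l \<ge> 1" "A \<ge> 0" "R \<ge> 0"
    and "\<And>j c. \<lbrakk>\<And>lam. lam \<in> S \<Longrightarrow> c lam \<noteq> 0;
        \<And>lam mu. \<lbrakk>lam \<in> S; mu \<in> S; mirror lam mu\<rbrakk> \<Longrightarrow>
          Re (c lam * c mu) \<le> - m * cmod (c lam * c mu) \<and> Im (c lam * c mu) \<le> - m * cmod (c lam * c mu)\<rbrakk> \<Longrightarrow>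
      \<exists>(x :: nat \<Rightarrow> real) r. (\<forall>n. \<bar>x n\<bar> \<le> A) \<and>
        (\<forall>lam\<in>S. 2 * real (l * T) \<le> r lam \<and> r lam \<le> R \<and> (\<forall>mu\<in>S. mirror lam mu \<longrightarrow> r mu = r lam) \<and>
          cnj (\<Sum>n<l * T. complex_of_real (x n) * (\<Phi> lam (j * T + n))\<^sup>2) * cnj (c lam)
            = (- complex_of_real (\<Sum>n<l * T. x n * (cmod (\<Phi> lam (j * T + n)))\<^sup>2)
                + 2 * \<i> * complex_of_real (r lam)) * c lam)"
proof -
  obtain L0 B where B: "B \<ge> 0" and mom: "\<And>t \<tau>. \<lbrakk>\<And>lam. lam \<in> S \<Longrightarrow> cmod (t lam) \<le> \<tau>;
        \<And>lam mu. \<lbrakk>lam \<in> S; mu \<in> S; mirror lam mu\<rbrakk> \<Longrightarrow> t mu = cnj (t lam)\<rbrakk> \<Longrightarrow>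
      \<exists>x :: nat \<Rightarrow> real. (\<forall>n. \<bar>x n\<bar> \<le> B * \<tau>) \<and>
        (\<forall>N\<ge>L0. (\<forall>lam\<in>S. (\<Sum>n<N. x n * (\<Phi> lam n)\<^sup>2) = t lam) \<and>
          (\<forall>f :: nat \<Rightarrow> complex. multiplier T 1 f \<longrightarrow> (\<Sum>n<N. x n * f n) = 0))"
    by (rule prescribed_moments[OF S]) blast
  define l where "l = Suc L0"
  define L where "L = l * T"
  have "L0 * 1 \<le> Suc L0 * T" "1 * 1 \<le> Suc L0 * T" using T_pos by (intro mult_le_mono; simp)+
  then have L: "L \<ge> L0" "L \<ge> 1" by (simp_all only: L_def l_def mult_1_right)
  define G where "G lam = (\<Sum>n<L. (cmod (\<Phi> lam n))\<^sup>2)" for lam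
  define E where "E = (\<Sum>lam\<in>S. G lam)"
  define h where "h = Min (insert 1 (G ` S))"
  have Gpos: "G lam > 0" if "lam \<in> S" for lam
    unfolding G_def using L(2) solution_nonzero[of lam] that S by (intro sum_pos) (auto simp: lessThan_empty_iff)
  have h: "h > 0" "\<And>lam. lam \<in> S \<Longrightarrow> h \<le> G lam"
    using S Gpos by (auto simp: h_def)
  have E: "G lam \<le> E" if "lam \<in> S" for lam
    unfolding E_def using that S Gpos by (intro member_le_sum) (auto intro: less_imp_le)
  have E0: "E \<ge> 0" unfolding E_def using Gpos by (intro sum_nonneg) (auto intro: less_imp_le)
  \<comment> \<open>with this constant the rate \<open>Y * Im (c * d) / (2 * Re (c * d)) \<ge> Y * m / 2\<close> of a mirror pair is at least \<open>2 * L\<close>\<close>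
  define y where "y = 4 * L / (m * h)"
  have y: "y > 0" using L m h(1) by (simp add: y_def)
  define Y where "Y lam = y * G lam" for lam
  have Y: "4 * L / m \<le> Y lam" "Y lam \<le> y * E" if "lam \<in> S" for lam
  proof -
    have "4 * L / m = y * h" using h(1) m by (simp add: y_def)
    also have "\<dots> \<le> Y lam" unfolding Y_def using h(2)[OF that] y by (intro mult_left_mono) auto
    finally show "4 * L / m \<le> Y lam" .
    show "Y lam \<le> y * E" unfolding Y_def using E[OF that] y by (intro mult_left_mono) auto
  qed
  define R where "R = y * E / (2 * m) + 2 * L"
  have R0: "R \<ge> 0" using y E0 m by (simp add: R_def)
  define \<tau> where "\<tau> = 2 * (y * E) + 2 * R"
  have \<tau>0: "\<tau> \<ge> 0" using y E0 R0 by (simp add: \<tau>_def)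
  define A where "A = y + B * \<tau>"
  have A0: "A \<ge> 0" using y B \<tau>0 by (simp add: A_def)
  have l1: "l \<ge> 1" by (simp add: l_def)
  have main: "\<exists>(x :: nat \<Rightarrow> real) r. (\<forall>n. \<bar>x n\<bar> \<le> A) \<and>
        (\<forall>lam\<in>S. 2 * real (l * T) \<le> r lam \<and> r lam \<le> R \<and> (\<forall>mu\<in>S. mirror lam mu \<longrightarrow> r mu = r lam) \<and>
          cnj (\<Sum>n<l * T. complex_of_real (x n) * (\<Phi> lam (j * T + n))\<^sup>2) * cnj (c lam)
            = (- complex_of_real (\<Sum>n<l * T. x n * (cmod (\<Phi> lam (j * T + n)))\<^sup>2)
                + 2 * \<i> * complex_of_real (r lam)) * c lam)"
    if nz: "\<And>lam. lam \<in> S \<Longrightarrow> c lam \<noteq> 0"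
      and sec: "\<And>lam mu. \<lbrakk>lam \<in> S; mu \<in> S; mirror lam mu\<rbrakk> \<Longrightarrow>
        Re (c lam * c mu) \<le> - m * cmod (c lam * c mu) \<and> Im (c lam * c mu) \<le> - m * cmod (c lam * c mu)"
    for j c
  proof -
    define p where "p lam = (SOME mu. mu \<in> S \<and> mirror lam mu)" for lam
    have p: "p lam = mu" if "lam \<in> S" "mu \<in> S" "mirror lam mu" for lam mu
      unfolding p_def using that mirror_unique[of lam] S by (intro some_equality) blast+
    define r where "r lam = (if \<exists>mu\<in>S. mirror lam mu
      then Y lam * Im (c lam * c (p lam)) / (2 * Re (c lam * c (p lam))) else 2 * L)" for lam
    have r_mirror: "r lam = Y lam * Im (c lam * c mu) / (2 * Re (c lam * c mu))"
      if "lam \<in> S" "mu \<in> S" "mirror lam mu" for lam mu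
      using that p[OF that] by (auto simp: r_def)
    have Y_mirror: "Y mu = Y lam" if "mirror lam mu" for lam mu
      using mirror_modulus[OF that] by (simp add: Y_def G_def)
    have r_sym: "r mu = r lam" if "lam \<in> S" "mu \<in> S" "mirror lam mu" for lam mu
      using r_mirror[OF that] r_mirror[OF that(2,1) mirror_sym[OF that(3)]] Y_mirror[OF that(3)]
      by (simp add: mult.commute)
    have r: "2 * real L \<le> r lam" "r lam \<le> R" if lam: "lam \<in> S" for lam
    proof -
      have "2 * real L \<le> r lam \<and> r lam \<le> R"
      proof (cases "\<exists>mu\<in>S. mirror lam mu")
        case False
        then show ?thesis using y E0 m by (auto simp: r_def R_def)
      next
        case True
        then obtain mu where mu: "mu \<in> S" "mirror lam mu" by blast
        define Q where "Q = c lam * c mu"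
        have P: "cmod Q > 0" using nz lam mu by (simp add: Q_def)
        have s: "Re Q \<le> - m * cmod Q" "Im Q \<le> - m * cmod Q" using sec[OF lam mu] unfolding Q_def by auto
        have "m * cmod Q > 0" using m P by simp
        then have neg: "Re Q < 0" "Im Q < 0" using s by linarith+
        have k1: "m \<le> Im Q / Re Q"
        proof -
          have "Im Q \<le> m * Re Q"
          proof -
            have "- Re Q \<le> cmod Q" using abs_Re_le_cmod[of Q] by linarith
            then have "m * (- Re Q) \<le> m * cmod Q" using m by (intro mult_left_mono) auto
            then show ?thesis using s by simp
          qed
          then show ?thesis using neg by (simp add: le_divide_eq)
        qed
        have k2: "Im Q / Re Q \<le> 1 / m"
        proof -
          have "- Im Q \<le> cmod Q" using abs_Im_le_cmod[of Q] by linarith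
          then have "m * (- Im Q) \<le> m * cmod Q" using m by (intro mult_left_mono) auto
          then have "Re Q \<le> m * Im Q" using s by simp
          then have "Re Q / m \<le> Im Q" using m by (simp add: divide_le_eq mult.commute)
          then show ?thesis using neg by (simp add: divide_le_eq)
        qed
        have req: "r lam = Y lam / 2 * (Im Q / Re Q)" using r_mirror[OF lam mu] by (simp add: Q_def)
        have Y0: "Y lam \<ge> 0" unfolding Y_def using y Gpos[OF lam] by simp
        have "2 * real L = 4 * L / m / 2 * m" using m by simp
        also have "\<dots> \<le> Y lam / 2 * (Im Q / Re Q)"
          using Y(1)[OF lam] k1 m L Y0 by (intro mult_mono) auto
        finally have 1: "2 * real L \<le> r lam" using req by simp
        have "r lam \<le> y * E / 2 * (1 / m)" unfolding req
          using Y(2)[OF lam] k2 k1 m Y0 by (intro mult_mono) auto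
        also have "\<dots> \<le> R" using L by (simp add: R_def)
        finally show ?thesis using 1 by blast
      qed
      then show "2 * real L \<le> r lam" "r lam \<le> R" by auto
    qed
    define w where "w lam = - complex_of_real (Y lam) + 2 * \<i> * complex_of_real (r lam)" for lam
    define Z where "Z lam = w lam * c lam / cnj (c lam)" for lam
    have Zc: "Z lam * cnj (c lam) = w lam * c lam" if "lam \<in> S" for lam
      using nz[OF that] by (simp add: Z_def)
    have Zn: "cmod (Z lam) \<le> y * E + 2 * R" if "lam \<in> S" for lam
    proof -
      have "cmod (Z lam) = cmod (w lam)" using nz[OF that] by (simp add: Z_def norm_mult norm_divide)
      also have "\<dots> \<le> cmod (- complex_of_real (Y lam)) + cmod (2 * \<i> * complex_of_real (r lam))"
        unfolding w_def by (rule norm_triangle_ineq)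
      also have "\<dots> = \<bar>Y lam\<bar> + 2 * \<bar>r lam\<bar>" by (simp add: norm_mult)
      also have "\<dots> \<le> y * E + 2 * R"
      proof -
        have "0 \<le> Y lam" unfolding Y_def using y Gpos[OF that] by simp
        moreover have "0 \<le> r lam" using r(1)[OF that] of_nat_0_le_iff[of L] by linarith
        ultimately show ?thesis using Y(2)[OF that] r(2)[OF that] by linarith
      qed
      finally show ?thesis .
    qed
    \<comment> \<open>the rate of a mirror pair is chosen to make the phases of both targets agree\<close>
    have Z_mirror: "Z mu = cnj (Z lam)" if "lam \<in> S" "mu \<in> S" "mirror lam mu" for lam mu
    proof -
      let ?P = "c lam * c mu"
      have P: "cmod ?P > 0" using nz that by simp
      then have "m * cmod ?P > 0" using m by simp
      then have neg: "Re ?P < 0" using sec[OF that] by linarith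
      have w: "w mu = w lam" using Y_mirror[OF that(3)] r_sym[OF that] by (simp add: w_def)
      have "Im (w lam * ?P) = - Y lam * Im ?P + 2 * r lam * Re ?P"
        by (simp add: w_def algebra_simps)
      also have "\<dots> = 0" using neg by (simp add: r_mirror[OF that] field_simps)
      finally have im: "Im (w lam * ?P) = 0" .
      have "cnj v = v" if "Im v = 0" for v using that by (simp add: complex_eq_iff)
      from this[OF im] have real: "cnj (w lam * ?P) = w lam * ?P" .
      have "Z mu = w lam * ?P / (c lam * cnj (c mu))" using nz[OF that(1)] by (simp add: Z_def w)
      also have "\<dots> = cnj (w lam * ?P) / (c lam * cnj (c mu))" by (simp only: real)
      also have "\<dots> = cnj (Z lam)" using nz[OF that(2)] by (simp add: Z_def)
      finally show ?thesis .
    qed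
    define z where "z lam = (\<zeta> lam)\<^sup>2" for lam
    have z: "cmod (z lam) = 1" if "lam \<in> S" for lam
      using unimodular that S by (auto simp: z_def norm_power)
    \<comment> \<open>moments are prescribed on the first cell: shift the target back by \<open>j\<close> periods and subtract the share of the constant \<open>y\<close>\<close>
    define t where "t lam = cnj (Z lam) / z lam ^ j - complex_of_real y * (\<Sum>n<L. (\<Phi> lam n)\<^sup>2)" for lam
    have t1: "cmod (t lam) \<le> \<tau>" if "lam \<in> S" for lam
    proof -
      have "cmod (t lam) \<le> cmod (cnj (Z lam) / z lam ^ j) + cmod (complex_of_real y * (\<Sum>n<L. (\<Phi> lam n)\<^sup>2))"
        unfolding t_def by (rule norm_triangle_ineq4)
      moreover have "cmod (cnj (Z lam) / z lam ^ j) \<le> y * E + 2 * R"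
        using Zn[OF that] z[OF that] by (simp add: norm_divide norm_power)
      moreover have "cmod (complex_of_real y * (\<Sum>n<L. (\<Phi> lam n)\<^sup>2)) \<le> y * E"
      proof -
        have "cmod (\<Sum>n<L. (\<Phi> lam n)\<^sup>2) \<le> G lam"
          unfolding G_def by (rule order_trans[OF norm_sum]) (simp add: norm_power)
        then have "cmod (\<Sum>n<L. (\<Phi> lam n)\<^sup>2) \<le> E" using E[OF that] by linarith
        then show ?thesis using y by (simp add: norm_mult)
      qed
      ultimately show ?thesis by (simp add: \<tau>_def)
    qed
    have t2: "t mu = cnj (t lam)" if "lam \<in> S" "mu \<in> S" "mirror lam mu" for lam mu
    proof -
      have "(\<Sum>n<L. (\<Phi> mu n)\<^sup>2) = cnj (\<Sum>n<L. (\<Phi> lam n)\<^sup>2)"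
        using that(3) by (simp add: mirror_def)
      moreover have "z mu = cnj (z lam)" using mirror_multiplier[of lam mu] that S by (auto simp: z_def)
      ultimately show ?thesis using Z_mirror[OF that] by (simp add: t_def)
    qed
    obtain x' :: "nat \<Rightarrow> real" where x': "\<And>n. \<bar>x' n\<bar> \<le> B * \<tau>"
      "\<And>lam. lam \<in> S \<Longrightarrow> (\<Sum>n<L. x' n * (\<Phi> lam n)\<^sup>2) = t lam"
      "\<And>f :: nat \<Rightarrow> complex. multiplier T 1 f \<Longrightarrow> (\<Sum>n<L. x' n * f n) = 0"
      using mom[of t \<tau>, OF t1 t2] L(1) by blast
    define x where "x n = y + x' n" for n
    have "\<bar>x n\<bar> \<le> A" for n
      using abs_triangle_ineq[of y "x' n"] x'(1)[of n] y by (simp add: x_def A_def)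
    moreover have "cnj (\<Sum>n<L. complex_of_real (x n) * (\<Phi> lam (j * T + n))\<^sup>2) * cnj (c lam)
            = (- complex_of_real (\<Sum>n<L. x n * (cmod (\<Phi> lam (j * T + n)))\<^sup>2)
                + 2 * \<i> * complex_of_real (r lam)) * c lam" if lam: "lam \<in> S" for lam
    proof -
      have lam': "lam \<in> \<Lambda>" using lam S by auto
      have sh: "(\<Phi> lam (j * T + n))\<^sup>2 = z lam ^ j * (\<Phi> lam n)\<^sup>2" for n
        unfolding shift_periods[OF lam'] z_def power_mult_distrib power_mult[symmetric]
        by (simp add: mult.commute)
      have "(\<Sum>n<L. complex_of_real (x n) * (\<Phi> lam (j * T + n))\<^sup>2)
          = z lam ^ j * (\<Sum>n<L. complex_of_real (x n) * (\<Phi> lam n)\<^sup>2)"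
        by (simp only: sh sum_distrib_left mult.left_commute)
      also have "(\<Sum>n<L. complex_of_real (x n) * (\<Phi> lam n)\<^sup>2) = y * (\<Sum>n<L. (\<Phi> lam n)\<^sup>2) + t lam"
        using x'(2)[OF lam] by (simp add: x_def algebra_simps sum.distrib sum_distrib_left)
      also have "z lam ^ j * \<dots> = cnj (Z lam)"
        using z[OF lam] by (simp add: t_def) (metis norm_zero zero_neq_one)
      finally have 1: "(\<Sum>n<L. complex_of_real (x n) * (\<Phi> lam (j * T + n))\<^sup>2) = cnj (Z lam)" .
      have "complex_of_real (\<Sum>n<L. x' n * (cmod (\<Phi> lam n))\<^sup>2) = 0"
        using x'(3)[OF modulus_periodic[OF lam']] by simp
      then have 0: "(\<Sum>n<L. x' n * (cmod (\<Phi> lam n))\<^sup>2) = 0" by (simp only: of_real_eq_0_iff)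
      have "(\<Sum>n<L. x n * (cmod (\<Phi> lam (j * T + n)))\<^sup>2) = (\<Sum>n<L. x n * (cmod (\<Phi> lam n))\<^sup>2)"
        by (simp add: shift_periods[OF lam'] norm_mult norm_power unimodular[OF lam'])
      also have "\<dots> = Y lam + (\<Sum>n<L. x' n * (cmod (\<Phi> lam n))\<^sup>2)"
        by (simp add: x_def Y_def G_def algebra_simps sum.distrib sum_distrib_left)
      finally have 2: "(\<Sum>n<L. x n * (cmod (\<Phi> lam (j * T + n)))\<^sup>2) = Y lam" by (simp add: 0)
      show ?thesis unfolding 1 2 using Zc[OF lam] by (simp add: w_def)
    qed
    ultimately show ?thesis using r r_sym unfolding L_def[symmetric] by blast
  qed
  show ?thesis by (rule that[OF l1 A0 R0 main])
qed

end

section \<open>One cell of the construction\<close>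

context resonance_family
begin

text \<open>
  The amplitude of the solution with \<open>u 0 = 0\<close> and \<open>u 1 = 1\<close>.
\<close>

definition start :: "real \<Rightarrow> complex" where
  "start lam = - \<i> * complex_of_real (\<alpha> 0) * cnj (\<Phi> lam 0)"

definition amp :: "real \<Rightarrow> (nat \<Rightarrow> real) \<Rightarrow> nat \<Rightarrow> complex" where
  "amp lam q = amplitude (\<Phi> lam) q (start lam)"

definition solution :: "real \<Rightarrow> (nat \<Rightarrow> real) \<Rightarrow> nat \<Rightarrow> real" where
  "solution lam q n = Re (\<Phi> lam n * amp lam q n)"

text \<open>
  The condition under which both amplitudes of every mirror pair can shrink together: their product lies in
  the open third quadrant, by a margin \<open>m\<close>.
\<close>

definition phase_locked :: "real \<Rightarrow> (nat \<Rightarrow> real) \<Rightarrow> nat \<Rightarrow> bool" where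
  "phase_locked m q s \<longleftrightarrow> (\<forall>lam\<in>\<Lambda>. \<forall>mu\<in>\<Lambda>. mirror lam mu \<longrightarrow>
     Re (amp lam q s * amp mu q s) \<le> - m * cmod (amp lam q s * amp mu q s) \<and>
     Im (amp lam q s * amp mu q s) \<le> - m * cmod (amp lam q s * amp mu q s))"

lemma amp_nonzero: "lam \<in> \<Lambda> \<Longrightarrow> amp lam q n \<noteq> 0"
  unfolding amp_def
  by (intro amplitude_nonzero) (use \<alpha>_pos[of 0] solution_nonzero[of lam 0] in \<open>auto simp: start_def\<close>)

lemma amp_cong: "(\<And>k. k < n \<Longrightarrow> q k = q' k) \<Longrightarrow> amp lam q n = amp lam q' n"
  unfolding amp_def by (rule amplitude_cong)

lemma Re_same_phase: "Re (z * (\<i> * complex_of_real k * cnj z)) = 0"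
  by (simp add: algebra_simps)

lemma amp_Suc: "amp lam q (Suc n) = amp lam q n
    + \<i> * complex_of_real (q n * solution lam q n) * cnj (\<Phi> lam n)"
  by (simp add: amp_def solution_def)

lemma solution_Suc: "Re (\<Phi> lam n * amp lam q (Suc n)) = solution lam q n"
  unfolding amp_Suc distrib_left plus_complex.sel Re_same_phase by (simp add: solution_def)

lemma solution_0: "solution lam q 0 = 0"
  by (simp add: solution_def amp_def start_def algebra_simps)

lemma amp_1: "amp lam q 1 = start lam"
  using amp_Suc[of lam q 0] by (simp add: solution_0) (simp add: amp_def)

lemma solution_1: "lam \<in> \<Lambda> \<Longrightarrow> solution lam q 1 = 1"
  using wronskian[of lam 0] by (simp add: solution_def amp_1[simplified] start_def algebra_simps)

lemma solution_equation:
  assumes lam: "lam \<in> \<Lambda>"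
  shows "\<alpha> (Suc n) * solution lam q (Suc (Suc n)) + (b (Suc n) + q (Suc n)) * solution lam q (Suc n)
    + \<alpha> n * solution lam q n = lam * solution lam q (Suc n)"
proof -
  define u where "u = solution lam q (Suc n)"
  define c where "c = amp lam q (Suc (Suc n))"
  have rec: "\<alpha> (Suc n) * \<Phi> lam (Suc (Suc n)) = (lam - b (Suc n)) * \<Phi> lam (Suc n) - \<alpha> n * \<Phi> lam n"
    using recurrence[OF lam, of n] by (simp add: algebra_simps)
  have "\<alpha> (Suc n) * solution lam q (Suc (Suc n)) = Re (\<alpha> (Suc n) * \<Phi> lam (Suc (Suc n)) * c)"
    by (simp add: solution_def c_def algebra_simps)
  also have "\<dots> = (lam - b (Suc n)) * Re (\<Phi> lam (Suc n) * c) - \<alpha> n * Re (\<Phi> lam n * c)"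
    unfolding rec by (simp add: algebra_simps)
  also have "Re (\<Phi> lam (Suc n) * c) = u" unfolding c_def u_def by (rule solution_Suc)
  also have "Re (\<Phi> lam n * c) = solution lam q n + q (Suc n) * u * Im (\<Phi> lam (Suc n) * cnj (\<Phi> lam n))"
  proof -
    have "\<Phi> lam n * c = \<Phi> lam n * amp lam q (Suc n)
        + \<i> * complex_of_real (q (Suc n) * u) * (\<Phi> lam n * cnj (\<Phi> lam (Suc n)))"
      unfolding c_def amp_Suc[of lam q "Suc n"] u_def by (simp add: algebra_simps)
    then have "Re (\<Phi> lam n * c) = solution lam q n
        + Re (\<i> * complex_of_real (q (Suc n) * u) * (\<Phi> lam n * cnj (\<Phi> lam (Suc n))))"
      by (simp only: plus_complex.sel solution_Suc)
    also have "Re (\<i> * complex_of_real (q (Suc n) * u) * (\<Phi> lam n * cnj (\<Phi> lam (Suc n))))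
        = q (Suc n) * u * Im (\<Phi> lam (Suc n) * cnj (\<Phi> lam n))"
      by (simp add: algebra_simps)
    finally show ?thesis .
  qed
  finally have "\<alpha> (Suc n) * solution lam q (Suc (Suc n)) = (lam - b (Suc n)) * u - \<alpha> n * solution lam q n
      - q (Suc n) * u * (\<alpha> n * Im (\<Phi> lam (Suc n) * cnj (\<Phi> lam n)))"
    by (simp add: algebra_simps)
  then show ?thesis unfolding wronskian[OF lam, of n] by (simp add: u_def algebra_simps)
qed

text \<open>
  For a mirror pair \<open>\<Phi> mu 0 = \<Phi> lam 0\<close> and \<open>\<Phi> mu 1 = - cnj (\<Phi> lam 1)\<close>. Without a potential the product of the amplitudes is
  the negative number \<open>- (\<alpha> 0 * \<Phi> lam 0)\<^sup>2\<close>; the value \<open>\<epsilon>\<close> at site \<open>1\<close> adds the imaginary part \<open>- 2 * \<epsilon>\<close> by the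
  normalisation of the Wronskian, and a real part of order \<open>\<epsilon>\<^sup>2\<close>.
\<close>

lemma initial_phase_lock:
  assumes lam: "lam \<in> \<Lambda>" and mu: "mu \<in> \<Lambda>" and mir: "mirror lam mu"
    and q: "q 1 = \<epsilon>" "\<epsilon> > 0" and \<epsilon>: "\<epsilon> * cmod (\<Phi> lam 1) < \<alpha> 0 * cmod (\<Phi> lam 0)"
  shows "Re (amp lam q 2 * amp mu q 2) < 0" "Im (amp lam q 2 * amp mu q 2) < 0"
proof -
  define f where "f = Re (\<Phi> lam 0)"
  have f: "\<Phi> lam 0 = f" "f > 0" using initial_value[OF lam] by (auto simp: f_def)
  have "\<Phi> mu 0 = complex_of_real (cmod (\<Phi> mu 0))"
    using initial_value[OF mu] by (metis abs_of_pos norm_of_real)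
  also have "\<dots> = f" using mirror_modulus[OF mir, of 0] f by simp
  finally have mu0: "\<Phi> mu 0 = f" .
  define p where "p = \<Phi> lam 1"
  have W: "\<alpha> 0 * (Im p * f) = 1" "\<alpha> 0 * (Im (\<Phi> mu 1) * f) = 1"
    using wronskian[OF lam, of 0] wronskian[OF mu, of 0] f mu0 by (simp_all add: p_def)
  have mu1: "\<Phi> mu 1 = - cnj p"
  proof -
    have "(\<Phi> mu 1)\<^sup>2 = (cnj p)\<^sup>2" using mir by (simp add: mirror_def p_def)
    then have "\<Phi> mu 1 = cnj p \<or> \<Phi> mu 1 = - cnj p" by (simp only: power2_eq_iff)
    moreover have "\<Phi> mu 1 \<noteq> cnj p" using W by auto
    ultimately show ?thesis by blast
  qed
  have amp2: "amp nu q 2 = start nu + \<i> * complex_of_real \<epsilon> * cnj (\<Phi> nu 1)" if "nu \<in> \<Lambda>" for nu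
    using amp_Suc[of nu q 1] amp_1[of nu q] solution_1[OF that, of q] q by (simp add: numeral_2_eq_2)
  have "amp lam q 2 * amp mu q 2
      = complex_of_real (\<epsilon>\<^sup>2) * (p * cnj p) - complex_of_real ((\<alpha> 0 * f)\<^sup>2)
        - complex_of_real (\<epsilon> * (\<alpha> 0 * f)) * (p - cnj p)"
    unfolding amp2[OF lam] amp2[OF mu] mu1 start_def mu0 f(1) p_def[symmetric]
    by (simp add: algebra_simps power2_eq_square)
  also have "\<dots> = complex_of_real (\<epsilon>\<^sup>2 * (cmod p)\<^sup>2 - (\<alpha> 0 * f)\<^sup>2)
      - complex_of_real (\<epsilon> * (\<alpha> 0 * f)) * (2 * \<i> * complex_of_real (Im p))"
    by (simp only: complex_norm_square complex_diff_cnj of_real_diff of_real_mult) (simp add: algebra_simps)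
  finally have P: "amp lam q 2 * amp mu q 2 = complex_of_real (\<epsilon>\<^sup>2 * (cmod p)\<^sup>2 - (\<alpha> 0 * f)\<^sup>2)
      - complex_of_real (\<epsilon> * (\<alpha> 0 * f)) * (2 * \<i> * complex_of_real (Im p))" .
  have "(\<epsilon> * cmod p)\<^sup>2 < (\<alpha> 0 * f)\<^sup>2"
    using \<epsilon> q(2) f by (intro power_strict_mono) (auto simp: p_def)
  then show "Re (amp lam q 2 * amp mu q 2) < 0" unfolding P by (simp add: power_mult_distrib)
  have "Im (amp lam q 2 * amp mu q 2) = - 2 * \<epsilon> * (\<alpha> 0 * (Im p * f))" unfolding P by simp
  then show "Im (amp lam q 2 * amp mu q 2) < 0" using q(2) W(1) by simp
qed

text \<open>
  One cell, started far out, with the weights of \<open>steering\<close>. The margin of the phase lock at position \<open>s\<close> is \<open>m * (1 + 1 / sqrt s)\<close>: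
  it stays above \<open>m\<close>, and on a cell starting at \<open>s\<close> it decreases by an amount of order \<open>s\<close> to the power \<open>- 3 / 2\<close>, more than
  the drift of order \<open>1 / s\<^sup>2\<close>. The weights are chosen for the margin \<open>m\<close>, so their bound does not depend on the cell.
\<close>

lemma cell_step:
  assumes S: "finite S" "S \<subseteq> \<Lambda>"
    and mir: "\<And>lam mu. \<lbrakk>lam \<in> \<Lambda>; mu \<in> \<Lambda>; mirror lam mu\<rbrakk> \<Longrightarrow> lam \<in> S"
    and m: "m > 0" and K: "filterlim K at_top sequentially"
  shows "\<exists>l\<ge>1. \<exists>M. \<forall>j\<ge>M. \<forall>q. phase_locked (m * (1 + 1 / sqrt (real (j * T)))) q (j * T) \<longrightarrow>
    (\<exists>q'. (\<forall>n<j * T. q' n = q n) \<and> (\<forall>n\<in>{j * T..<(j + l) * T}. \<bar>q' n\<bar> \<le> K n / real n) \<and>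
      phase_locked (m * (1 + 1 / sqrt (real ((j + l) * T)))) q' ((j + l) * T) \<and>
      (\<forall>lam\<in>S. (\<forall>n\<in>{j * T..(j + l) * T}. real n * cmod (amp lam q' n) \<le> 4 * (real (j * T) * cmod (amp lam q (j * T)))) \<and>
        real ((j + l) * T) * cmod (amp lam q' ((j + l) * T)) \<le> real (j * T) * cmod (amp lam q (j * T))))"
proof -
  obtain l :: nat and A R :: real where l: "l \<ge> 1" and A: "A \<ge> 0" and R: "R \<ge> 0"
    and steer: "\<And>j c. \<lbrakk>\<And>lam. lam \<in> S \<Longrightarrow> c lam \<noteq> 0;
        \<And>lam mu. \<lbrakk>lam \<in> S; mu \<in> S; mirror lam mu\<rbrakk> \<Longrightarrow>
          Re (c lam * c mu) \<le> - m * cmod (c lam * c mu) \<and> Im (c lam * c mu) \<le> - m * cmod (c lam * c mu)\<rbrakk> \<Longrightarrow>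
      \<exists>(x :: nat \<Rightarrow> real) r. (\<forall>n. \<bar>x n\<bar> \<le> A) \<and>
        (\<forall>lam\<in>S. 2 * real (l * T) \<le> r lam \<and> r lam \<le> R \<and> (\<forall>mu\<in>S. mirror lam mu \<longrightarrow> r mu = r lam) \<and>
          cnj (\<Sum>n<l * T. complex_of_real (x n) * (\<Phi> lam (j * T + n))\<^sup>2) * cnj (c lam)
            = (- complex_of_real (\<Sum>n<l * T. x n * (cmod (\<Phi> lam (j * T + n)))\<^sup>2)
                + 2 * \<i> * complex_of_real (r lam)) * c lam)"
    by (rule steering[OF S m]) blast
  define L where "L = l * T"
  have L: "L \<ge> 1" using l T_pos by (simp add: L_def)
  define e where "e = (\<Sum>lam\<in>S. \<Sum>k<T. (cmod (\<Phi> lam k))\<^sup>2)"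
  have e: "(cmod (\<Phi> lam n))\<^sup>2 \<le> e" if "lam \<in> S" for lam n
  proof -
    have "(cmod (\<Phi> lam n))\<^sup>2 \<le> (\<Sum>k<T. (cmod (\<Phi> lam k))\<^sup>2)" using solution_bounded that S by blast
    also have "\<dots> \<le> e" unfolding e_def using that S by (intro member_le_sum) (auto intro: sum_nonneg)
    finally show ?thesis .
  qed
  have e0: "e \<ge> 0" unfolding e_def by (intro sum_nonneg) auto
  define C where "C = L * 2 ^ L * (e * A)\<^sup>2"
  have C: "C \<ge> 0" by (simp add: C_def)
  have L0: "real L > 0" using L by simp
  have "\<forall>\<^sub>F s :: real in at_top. s \<ge> L \<and> 2 ^ L * (e * A) \<le> s \<and> 2 * R \<le> s"
    by (intro eventually_conj eventually_ge_at_top)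
  moreover have "\<forall>\<^sub>F s :: real in at_top. C / s + C * L / s\<^sup>2 < L"
  proof -
    have "((\<lambda>s :: real. C / s + C * L / s\<^sup>2) \<longlongrightarrow> 0) at_top" by real_asymp
    from order_tendstoD(2)[OF this L0] show ?thesis .
  qed
  moreover have "\<forall>\<^sub>F s :: real in at_top. C / s\<^sup>2 < 1 / 24"
  proof -
    have "((\<lambda>s :: real. C / s\<^sup>2) \<longlongrightarrow> 0) at_top" by real_asymp
    moreover have "(0 :: real) < 1 / 24" by simp
    ultimately show ?thesis by (rule order_tendstoD(2))
  qed
  moreover have "\<forall>\<^sub>F s :: real in at_top. 48 * C / s\<^sup>2 < m * (1 / sqrt s - 1 / sqrt (s + L))"
    using L0 m by real_asymp
  ultimately have "\<forall>\<^sub>F s :: real in at_top. (s \<ge> L \<and> 2 ^ L * (e * A) \<le> s \<and> 2 * R \<le> s) \<and>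
      C / s + C * L / s\<^sup>2 < L \<and> C / s\<^sup>2 < 1 / 24 \<and> 48 * C / s\<^sup>2 < m * (1 / sqrt s - 1 / sqrt (s + L))"
    by eventually_elim blast
  then obtain M1 where M1: "\<And>s :: real. s \<ge> M1 \<Longrightarrow> (s \<ge> L \<and> 2 ^ L * (e * A) \<le> s \<and> 2 * R \<le> s) \<and>
      C / s + C * L / s\<^sup>2 < L \<and> C / s\<^sup>2 < 1 / 24 \<and> 48 * C / s\<^sup>2 < m * (1 / sqrt s - 1 / sqrt (s + L))"
    unfolding eventually_at_top_linorder by blast
  have "\<forall>\<^sub>F n in sequentially. 2 * A \<le> K n" using K unfolding filterlim_at_top by blast
  then obtain M2 where M2: "\<And>n. n \<ge> M2 \<Longrightarrow> 2 * A \<le> K n" unfolding eventually_sequentially by blast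
  define M where "M = max (nat \<lceil>M1\<rceil>) (max M2 1)"
  have "\<exists>q'. (\<forall>n<j * T. q' n = q n) \<and> (\<forall>n\<in>{j * T..<(j + l) * T}. \<bar>q' n\<bar> \<le> K n / real n) \<and>
      phase_locked (m * (1 + 1 / sqrt (real ((j + l) * T)))) q' ((j + l) * T) \<and>
      (\<forall>lam\<in>S. (\<forall>n\<in>{j * T..(j + l) * T}. real n * cmod (amp lam q' n) \<le> 4 * (real (j * T) * cmod (amp lam q (j * T)))) \<and>
        real ((j + l) * T) * cmod (amp lam q' ((j + l) * T)) \<le> real (j * T) * cmod (amp lam q (j * T)))"
    if j: "j \<ge> M" and lock: "phase_locked (m * (1 + 1 / sqrt (real (j * T)))) q (j * T)" for j q
  proof -
    define s where "s = j * T"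
    have sj: "s \<ge> j" using T_pos by (simp add: s_def)
    have s0: "s > 0" using sj j by (auto simp: M_def)
    have sM1: "real s \<ge> M1"
    proof -
      have "M1 \<le> real (nat \<lceil>M1\<rceil>)" by linarith
      also have "\<dots> \<le> real s" using j sj by (simp add: M_def)
      finally show ?thesis .
    qed
    note big = M1[OF sM1]
    have endpoint: "(j + l) * T = s + L" by (simp add: s_def L_def algebra_simps)
    let ?c = "\<lambda>lam. amp lam q s"
    have mul: "m \<le> m * (1 + 1 / sqrt (real s))" using m by simp
    have sec: "Re (?c lam * ?c mu) \<le> - m * cmod (?c lam * ?c mu) \<and> Im (?c lam * ?c mu) \<le> - m * cmod (?c lam * ?c mu)"
      if "lam \<in> S" "mu \<in> S" "mirror lam mu" for lam mu
    proof -
      have "m * cmod (?c lam * ?c mu) \<le> m * (1 + 1 / sqrt (real s)) * cmod (?c lam * ?c mu)"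
        using mul by (intro mult_right_mono) auto
      moreover have "Re (?c lam * ?c mu) \<le> - (m * (1 + 1 / sqrt (real s))) * cmod (?c lam * ?c mu) \<and>
          Im (?c lam * ?c mu) \<le> - (m * (1 + 1 / sqrt (real s))) * cmod (?c lam * ?c mu)"
        using lock that S unfolding phase_locked_def s_def[symmetric] by blast
      ultimately show ?thesis by (simp only: minus_mult_left[symmetric] le_minus_iff) linarith
    qed
    have nz: "?c lam \<noteq> 0" if "lam \<in> S" for lam using amp_nonzero that S by blast
    obtain x r where x: "\<And>n. \<bar>x n\<bar> \<le> A"
      and r: "\<And>lam. lam \<in> S \<Longrightarrow> 2 * real L \<le> r lam \<and> r lam \<le> R"
        "\<And>lam mu. \<lbrakk>lam \<in> S; mu \<in> S; mirror lam mu\<rbrakk> \<Longrightarrow> r mu = r lam"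
      and Z: "\<And>lam. lam \<in> S \<Longrightarrow> cnj (\<Sum>n<L. complex_of_real (x n) * (\<Phi> lam (s + n))\<^sup>2) * cnj (?c lam)
            = (- complex_of_real (\<Sum>n<L. x n * (cmod (\<Phi> lam (s + n)))\<^sup>2)
                + 2 * \<i> * complex_of_real (r lam)) * ?c lam"
      using steer[of ?c j, OF nz sec] unfolding s_def[symmetric] L_def[symmetric] by blast
    define q' where "q' n = (if n < s then q n else x (n - s) / s)" for n
    have q'1: "q' n = q n" if "n < s" for n using that by (simp add: q'_def)
    have q'2: "q' (s + n) = x n / s" for n by (simp add: q'_def)
    have same: "amp lam q' s = ?c lam" for lam by (rule amp_cong) (rule q'1)
    have sL: "real L \<le> real s" using big by blast
    have Kb: "\<bar>q' n\<bar> \<le> K n / real n" if "n \<in> {s..<s + L}" for n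
    proof -
      have n: "n \<ge> s" "n < s + L" using that by auto
      have "\<bar>q' n\<bar> \<le> A / s" using x[of "n - s"] n(1) s0 by (simp add: q'_def divide_right_mono)
      also have "A / s \<le> K n / real n"
      proof -
        have "2 * A \<le> K n" using M2[of n] n(1) sj j by (simp add: M_def)
        moreover have "real n \<le> 2 * real s" using n sL by linarith
        ultimately have "A * real n \<le> (K n / 2) * (2 * real s)"
          using A by (intro mult_mono) auto
        then show ?thesis using s0 n(1) by (simp add: divide_le_eq le_divide_eq field_simps)
      qed
      finally show ?thesis .
    qed
    note eff = cell_effect[where s = s and L = L and x = x and A = A and e = e and q = q',
        OF s0 x A _ e0 q'2]
    have bound2: "cmod (amp lam q' (s + k)) \<le> 2 * cmod (?c lam)" if "lam \<in> S" "k \<le> L" for lam k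
      using eff(1)[of "\<Phi> lam" "start lam" "r lam" k] e[OF that(1)] big Z[OF that(1)] that(2)
      unfolding amp_def[symmetric] same by blast
    have step: "cmod (amp lam q' (s + L) - complex_of_real (1 - r lam / s) * ?c lam) \<le> C / (real s)\<^sup>2 * cmod (?c lam)"
      if "lam \<in> S" for lam
      using eff(2)[of "\<Phi> lam" "start lam" "r lam"] e[OF that(1)] big Z[OF that(1)]
      unfolding amp_def[symmetric] same C_def of_nat_power by blast
    have decay: "real (s + L) * cmod (amp lam q' (s + L)) \<le> real s * cmod (?c lam)" if "lam \<in> S" for lam
      using cell_decay[of "real s" "real L" "r lam" C, OF _ _ _ _ _ step[OF that]] s0 r(1)[OF that] big R by auto
    have inside: "real n * cmod (amp lam q' n) \<le> 4 * (real s * cmod (?c lam))"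
      if "lam \<in> S" "n \<in> {s..s + L}" for lam n
    proof -
      have n: "n = s + (n - s)" "n - s \<le> L" using that by auto
      have "real n \<le> 2 * real s" using n(2) that(2) sL by auto
      moreover have "cmod (amp lam q' n) \<le> 2 * cmod (?c lam)" using bound2[OF that(1) n(2)] n(1) by simp
      ultimately have "real n * cmod (amp lam q' n) \<le> (2 * real s) * (2 * cmod (?c lam))"
        by (intro mult_mono) auto
      then show ?thesis by simp
    qed
    have lock': "phase_locked (m * (1 + 1 / sqrt (real (s + L)))) q' (s + L)"
      unfolding phase_locked_def
    proof (intro ballI impI)
      fix lam mu assume h: "lam \<in> \<Lambda>" "mu \<in> \<Lambda>" "mirror lam mu"
      have hS: "lam \<in> S" "mu \<in> S" using mir h mirror_sym by blast+
      have req: "r mu = r lam" using r(2)[OF hS h(3)] .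
      let ?m = "m * (1 + 1 / sqrt (real s))" and ?P = "amp lam q' (s + L) * amp mu q' (s + L)"
      have old: "Re (?c lam * ?c mu) \<le> - ?m * cmod (?c lam * ?c mu)"
          "Im (?c lam * ?c mu) \<le> - ?m * cmod (?c lam * ?c mu)"
        using lock h unfolding phase_locked_def s_def[symmetric] by blast+
      have \<rho>: "1 / 2 \<le> 1 - r lam / real s" "1 - r lam / real s \<le> 1"
      proof -
        have "r lam / s \<le> 1 / 2" using r(1)[OF hS(1)] big s0 by (simp add: divide_le_eq)
        then show "1 / 2 \<le> 1 - r lam / real s" by simp
        have "0 \<le> r lam" using r(1)[OF hS(1)] of_nat_0_le_iff[of L] by linarith
        then show "1 - r lam / real s \<le> 1" by simp
      qed
      have \<eta>: "0 \<le> C / (real s)\<^sup>2" "C / (real s)\<^sup>2 \<le> 1 / 24" using C big by auto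
      have m0: "0 \<le> ?m" using m by simp
      have d: "l ?P \<le> - (?m - 48 * (C / (real s)\<^sup>2)) * cmod ?P"
        if "l = Re \<or> l = Im" "l (?c lam * ?c mu) \<le> - ?m * cmod (?c lam * ?c mu)" for l
        by (rule sector_drift[OF that(1) nz[OF hS(1)] nz[OF hS(2)] \<rho> \<eta> step[OF hS(1)] _ m0 that(2)])
          (use step[OF hS(2)] req in simp)
      have "m * (1 + 1 / sqrt (real (s + L))) \<le> ?m - 48 * (C / (real s)\<^sup>2)"
        using big by (simp add: algebra_simps)
      then have "m * (1 + 1 / sqrt (real (s + L))) * cmod ?P \<le> (?m - 48 * (C / (real s)\<^sup>2)) * cmod ?P"
        by (intro mult_right_mono) auto
      then have weaken: "- (?m - 48 * (C / (real s)\<^sup>2)) * cmod ?P \<le> - (m * (1 + 1 / sqrt (real (s + L)))) * cmod ?P"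
        by (simp only: mult_minus_left neg_le_iff_le)
      show "Re ?P \<le> - (m * (1 + 1 / sqrt (real (s + L)))) * cmod ?P \<and>
          Im ?P \<le> - (m * (1 + 1 / sqrt (real (s + L)))) * cmod ?P"
        using order_trans[OF d[of Re] weaken] order_trans[OF d[of Im] weaken] old by blast
    qed
    show ?thesis unfolding endpoint s_def[symmetric]
      by (intro exI[of _ q'] conjI allI impI ballI q'1 Kb lock' inside decay)
  qed
  then show ?thesis using l by blast
qed

end

section \<open>A common potential for all energies\<close>

context resonance_family
begin

text \<open>
  Concatenate cells, where the cell starting at \<open>j * T\<close> controls the first \<open>k0 + stage j\<close> energies. All mirror pairs are under
  control from the beginning, since their phase lock would be lost while only one partner is steered. Once an energy is under control,
  the product of position and amplitude never grows at the ends of cells, and within a cell it is at most four times as large.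
\<close>

lemma decaying_solutions:
  fixes lam :: "nat \<Rightarrow> real" and K :: "nat \<Rightarrow> real"
  assumes lam: "\<Lambda> = lam ` {1..}"
    and mir: "\<And>x y. \<lbrakk>x \<in> \<Lambda>; y \<in> \<Lambda>; mirror x y\<rbrakk> \<Longrightarrow> x \<in> lam ` {1..k0}"
    and Kpos: "\<And>n. n \<ge> 1 \<Longrightarrow> K n > 0" and K: "filterlim K at_top sequentially"
  obtains q where "\<And>n. n \<ge> 1 \<Longrightarrow> \<bar>q n\<bar> \<le> K n / real n"
    and "\<And>x. x \<in> \<Lambda> \<Longrightarrow> summable (\<lambda>n. (cmod (amp x q n))\<^sup>2)"
proof -
  define S where "S k = lam ` {1..k0 + k}" for k
  have S: "finite (S k)" "S k \<subseteq> \<Lambda>" for k using lam by (auto simp: S_def)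
  have S_mono: "S k \<subseteq> S k'" if "k \<le> k'" for k k' using that by (auto simp: S_def)
  have S0: "lam ` {1..k0} = S 0" by (simp add: S_def)
  have mirS: "x \<in> S k" if "x \<in> \<Lambda>" "y \<in> \<Lambda>" "mirror x y" for x y k
    using mir[OF that] S_mono[of 0 k] unfolding S0 by blast
  \<comment> \<open>one nonzero value of the potential separates the phases of every mirror pair\<close>
  have "\<forall>\<^sub>F \<epsilon> in at_right 0. \<epsilon> * cmod (\<Phi> x 1) < \<alpha> 0 * cmod (\<Phi> x 0)" if "x \<in> S 0" for x
  proof -
    have "((\<lambda>\<epsilon>. \<epsilon> * cmod (\<Phi> x 1)) \<longlongrightarrow> 0 * cmod (\<Phi> x 1)) (at_right 0)" by (intro tendsto_intros)
    moreover have "x \<in> \<Lambda>" using that S(2)[of 0] by blast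
    then have "0 < \<alpha> 0 * cmod (\<Phi> x 0)" using \<alpha>_pos[of 0] solution_nonzero[of x 0] by simp
    ultimately show ?thesis using order_tendstoD(2) by (metis mult_zero_left)
  qed
  then have "\<forall>\<^sub>F \<epsilon> in at_right 0. \<forall>x\<in>S 0. \<epsilon> * cmod (\<Phi> x 1) < \<alpha> 0 * cmod (\<Phi> x 0)"
    using S(1) by (simp add: eventually_ball_finite_distrib)
  moreover have "\<forall>\<^sub>F \<epsilon> in at_right 0. (0 :: real) < \<epsilon> \<and> \<epsilon> < K 1"
    using eventually_at_right_real[OF Kpos[OF order_refl]] by simp
  ultimately have "\<forall>\<^sub>F \<epsilon> in at_right 0. (0 :: real) < \<epsilon> \<and> \<epsilon> < K 1 \<and>
      (\<forall>x\<in>S 0. \<epsilon> * cmod (\<Phi> x 1) < \<alpha> 0 * cmod (\<Phi> x 0))"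
    by eventually_elim blast
  then obtain \<epsilon> where \<epsilon>: "0 < \<epsilon>" "\<epsilon> < K 1" "\<And>x. x \<in> S 0 \<Longrightarrow> \<epsilon> * cmod (\<Phi> x 1) < \<alpha> 0 * cmod (\<Phi> x 0)"
    using eventually_happens'[OF trivial_limit_at_right_real] by blast
  define q0 where "q0 n = (if n = 1 then \<epsilon> else 0)" for n :: nat
  define pairs where "pairs = {(x, y). x \<in> S 0 \<and> y \<in> S 0 \<and> mirror x y}"
  have fin: "finite pairs" by (rule finite_subset[of _ "S 0 \<times> S 0"]) (use S(1) in \<open>auto simp: pairs_def\<close>)
  let ?P = "\<lambda>p. amp (fst p) q0 2 * amp (snd p) q0 2"
  define m where "m = Min (insert 1 ((\<lambda>p. min (- Re (?P p)) (- Im (?P p)) / cmod (?P p) / 2) ` pairs))"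
  have neg: "Re (?P p) < 0" "Im (?P p) < 0" "cmod (?P p) > 0" if pp: "p \<in> pairs" for p
  proof -
    obtain x y where p: "p = (x, y)" "x \<in> S 0" "y \<in> S 0" "mirror x y" using pp by (auto simp: pairs_def)
    then have "x \<in> \<Lambda>" "y \<in> \<Lambda>" using S by auto
    from initial_phase_lock[OF this p(4), of q0 \<epsilon>] amp_nonzero[OF this(1)] amp_nonzero[OF this(2)]
    show "Re (?P p) < 0" "Im (?P p) < 0" "cmod (?P p) > 0"
      using \<epsilon> p by (simp_all add: q0_def del: times_complex.sel)
  qed
  have m: "m > 0" unfolding m_def using fin neg by (subst Min_gr_iff) (auto simp del: times_complex.sel)
  have lock2: "phase_locked (2 * m) q0 2"
    unfolding phase_locked_def
  proof (intro ballI impI)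
    fix x y assume xy: "x \<in> \<Lambda>" "y \<in> \<Lambda>" "mirror x y"
    then have p: "(x, y) \<in> pairs" using mirS[of x y 0] mirS[of y x 0] mirror_sym by (auto simp: pairs_def)
    let ?Q = "amp x q0 2 * amp y q0 2"
    have "m \<le> min (- Re ?Q) (- Im ?Q) / cmod ?Q / 2"
      unfolding m_def by (rule Min_le) (use fin p in \<open>force simp del: times_complex.sel\<close>)+
    then have "2 * m * cmod ?Q \<le> min (- Re ?Q) (- Im ?Q)"
      using neg(3)[OF p] by (simp add: le_divide_eq field_simps del: times_complex.sel)
    then have "2 * m * cmod ?Q \<le> - Re ?Q" "2 * m * cmod ?Q \<le> - Im ?Q" by linarith+
    then show "Re ?Q \<le> - (2 * m) * cmod ?Q \<and> Im ?Q \<le> - (2 * m) * cmod ?Q"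
      by (simp del: times_complex.sel)
  qed
  define step where "step k l M \<longleftrightarrow> (\<forall>j\<ge>M. \<forall>q. phase_locked (m * (1 + 1 / sqrt (real (j * T)))) q (j * T) \<longrightarrow>
    (\<exists>q'. (\<forall>n<j * T. q' n = q n) \<and> (\<forall>n\<in>{j * T..<(j + l) * T}. \<bar>q' n\<bar> \<le> K n / real n) \<and>
      phase_locked (m * (1 + 1 / sqrt (real ((j + l) * T)))) q' ((j + l) * T) \<and>
      (\<forall>x\<in>S k. (\<forall>n\<in>{j * T..(j + l) * T}. real n * cmod (amp x q' n) \<le> 4 * (real (j * T) * cmod (amp x q (j * T)))) \<and>
        real ((j + l) * T) * cmod (amp x q' ((j + l) * T)) \<le> real (j * T) * cmod (amp x q (j * T)))))"
    for k and l M :: nat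
  have "\<exists>l\<ge>1. \<exists>M. step k l M" for k
    unfolding step_def by (rule cell_step[OF S(1) S(2) mirS m K])
  then obtain l M where lM: "\<And>k. l k \<ge> 1" "\<And>k. step k (l k) (M k)" by metis
  \<comment> \<open>\<open>M k\<close> is the number of periods after which the first \<open>k0 + k\<close> energies can be controlled\<close>
  define stage where "stage j = Max {k. k \<le> j \<and> M k \<le> j}" for j
  have fin_st: "finite {k. k \<le> j \<and> M k \<le> j}" for j by (rule finite_subset[of _ "{..j}"]) auto
  have stage1: "M (stage j) \<le> j" if "M 0 \<le> j" for j
    using Max_in[OF fin_st, of j] that unfolding stage_def by blast
  have stage2: "k \<le> stage j" if "k \<le> j" "M k \<le> j" for j k
    unfolding stage_def using that by (intro Max_ge[OF fin_st]) auto
  define P where "P i s \<longleftrightarrow> i \<le> fst s \<and> M 0 \<le> fst s \<and> (case s of (j, q) \<Rightarrow>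
      phase_locked (m * (1 + 1 / sqrt (real (j * T)))) q (j * T) \<and> (\<forall>n. 1 \<le> n \<and> n < j * T \<longrightarrow> \<bar>q n\<bar> \<le> K n / real n))"
    for i :: nat and s :: "nat \<times> (nat \<Rightarrow> real)"
  define Q where "Q s s' \<longleftrightarrow> (case s of (j, q) \<Rightarrow> case s' of (j', q') \<Rightarrow> j < j' \<and> (\<forall>n<j * T. q' n = q n) \<and>
      (\<forall>x\<in>S (stage j). (\<forall>n\<in>{j * T..j' * T}. real n * cmod (amp x q' n) \<le> 4 * (real (j * T) * cmod (amp x q (j * T)))) \<and>
        real (j' * T) * cmod (amp x q' (j' * T)) \<le> real (j * T) * cmod (amp x q (j * T))))"
    for s s' :: "nat \<times> (nat \<Rightarrow> real)"
  have "\<exists>s. P 0 s"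
  proof -
    define j where "j = max (M 0) 2"
    have j2: "2 \<le> j * T" using mult_le_mono[of 2 j 1 T] T_pos by (simp add: j_def)
    have eq: "amp x q0 (j * T) = amp x q0 2" for x
    proof -
      have "amp x q0 (2 + (j * T - 2)) = amp x q0 2"
        unfolding amp_def by (rule amplitude_const) (simp add: q0_def)
      then show ?thesis by (simp only: le_add_diff_inverse[OF j2])
    qed
    have "phase_locked (m * (1 + 1 / sqrt (real (j * T)))) q0 (j * T)"
      unfolding phase_locked_def eq
    proof (intro ballI impI)
      fix x y assume xy: "x \<in> \<Lambda>" "y \<in> \<Lambda>" "mirror x y"
      let ?Q = "amp x q0 2 * amp y q0 2"
      have "1 \<le> real (j * T)" using j2 by linarith
      then have "1 \<le> sqrt (real (j * T))" by (simp only: real_sqrt_ge_1_iff)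
      moreover have "1 / t \<le> 1" if "1 \<le> t" for t :: real using that by simp
      ultimately have "1 / sqrt (real (j * T)) \<le> 1" by blast
      then have "m * (1 + 1 / sqrt (real (j * T))) \<le> 2 * m" using mult_left_mono[of _ 2 m] m by simp
      then have "m * (1 + 1 / sqrt (real (j * T))) * cmod ?Q \<le> 2 * m * cmod ?Q" by (intro mult_right_mono) auto
      moreover have "Re ?Q \<le> - (2 * m) * cmod ?Q \<and> Im ?Q \<le> - (2 * m) * cmod ?Q"
        using lock2 xy unfolding phase_locked_def by blast
      ultimately show "Re ?Q \<le> - (m * (1 + 1 / sqrt (real (j * T)))) * cmod ?Q \<and>
          Im ?Q \<le> - (m * (1 + 1 / sqrt (real (j * T)))) * cmod ?Q"
        by (simp only: minus_mult_left[symmetric]) linarith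
    qed
    moreover have "\<bar>q0 n\<bar> \<le> K n / real n" if "1 \<le> n" for n
      using that \<epsilon> Kpos[OF that] by (auto simp: q0_def)
    ultimately have "P 0 (j, q0)" by (auto simp: P_def j_def)
    then show ?thesis by blast
  qed
  moreover have "\<exists>s'. P (Suc i) s' \<and> Q s s'" if Ps: "P i s" for i s
  proof -
    obtain j q where s: "s = (j, q)" by (cases s)
    define k where "k = stage j"
    have Mk: "M k \<le> j" using Ps stage1 by (simp add: P_def s k_def)
    have lock: "phase_locked (m * (1 + 1 / sqrt (real (j * T)))) q (j * T)"
      and old: "\<And>n. 1 \<le> n \<Longrightarrow> n < j * T \<Longrightarrow> \<bar>q n\<bar> \<le> K n / real n"
      using Ps by (auto simp: P_def s)
    obtain q' where q': "\<And>n. n < j * T \<Longrightarrow> q' n = q n"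
      "\<And>n. n \<in> {j * T..<(j + l k) * T} \<Longrightarrow> \<bar>q' n\<bar> \<le> K n / real n"
      "phase_locked (m * (1 + 1 / sqrt (real ((j + l k) * T)))) q' ((j + l k) * T)"
      "\<forall>x\<in>S k. (\<forall>n\<in>{j * T..(j + l k) * T}. real n * cmod (amp x q' n) \<le> 4 * (real (j * T) * cmod (amp x q (j * T)))) \<and>
        real ((j + l k) * T) * cmod (amp x q' ((j + l k) * T)) \<le> real (j * T) * cmod (amp x q (j * T))"
      using lM(2)[of k, unfolded step_def, rule_format, OF Mk lock] by blast
    have "\<bar>q' n\<bar> \<le> K n / real n" if "1 \<le> n" "n < (j + l k) * T" for n
      using old[of n] q'(1)[of n] q'(2)[of n] that by (cases "n < j * T") auto
    then have "P (Suc i) (j + l k, q')" using Ps q'(3) lM(1)[of k] by (auto simp: P_def s)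
    moreover have "Q s (j + l k, q')" using q'(1,4) lM(1)[of k] by (simp add: Q_def s k_def)
    ultimately show ?thesis by blast
  qed
  ultimately obtain f where f: "\<And>i. P i (f i)" "\<And>i. Q (f i) (f (Suc i))"
    using dependent_nat_choice[of P "\<lambda>_. Q"] by metis
  define J where "J i = fst (f i)" for i
  define Qs where "Qs i = snd (f i)" for i
  have fi: "f i = (J i, Qs i)" for i by (simp add: J_def Qs_def)
  have Ji: "i \<le> J i" "M 0 \<le> J i" for i using f(1)[of i] by (simp_all add: P_def J_def)
  have bd: "\<bar>Qs i n\<bar> \<le> K n / real n" if "1 \<le> n" "n < J i * T" for i n
    using f(1)[of i] that by (simp add: P_def fi)
  have Jlt: "J i < J (Suc i)" for i using f(2)[of i] by (simp add: Q_def fi)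
  have agree1: "Qs (Suc i) n = Qs i n" if "n < J i * T" for i n
    using f(2)[of i] that by (simp add: Q_def fi)
  have Jmono: "J i \<le> J i'" if "i \<le> i'" for i i' 
    by (rule lift_Suc_mono_le[where f = J, OF less_imp_le[OF Jlt] that])
  have agree: "Qs i' n = Qs i n" if "i \<le> i'" "n < J i * T" for i i' n
    using that(1)
  proof (induction i' rule: dec_induct)
    case (step k)
    have "n < J k * T" using that(2) Jmono[OF step.hyps(1)] by (meson less_le_trans mult_le_mono1)
    then show ?case using agree1[of n k] step by simp
  qed simp
  define q where "q n = Qs (Suc n) n" for n
  have below: "n < J (Suc n) * T" for n
    using mult_le_mono[OF Ji(1)[of "Suc n"] T_pos] by simp
  have q_eq: "q n = Qs i n" if "n < J i * T" for i n
    using agree[of i "Suc n" n] agree[of "Suc n" i n] that below[of n] unfolding q_def by (cases "i \<le> Suc n") auto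
  have amp_eq: "amp x q n = amp x (Qs i) n" if "n \<le> J i * T" for x i n
    by (rule amp_cong) (use q_eq that in auto)
  show thesis
  proof (rule that)
    show "\<bar>q n\<bar> \<le> K n / real n" if "n \<ge> 1" for n
      unfolding q_def using bd[OF that below] .
    fix x assume "x \<in> \<Lambda>"
    then obtain i where i: "i \<ge> 1" "x = lam i" using lam by auto
    define I where "I = max i (M i)"
    define D where "D h = real (J h * T) * cmod (amp x q (J h * T))" for h
    have dec: "(\<forall>n\<in>{J h * T..J (Suc h) * T}. real n * cmod (amp x q n) \<le> 4 * D h) \<and> D (Suc h) \<le> D h"
      if "h \<ge> I" for h
    proof -
      have "i \<le> stage (J h)" using Ji(1)[of h] that by (intro stage2) (auto simp: I_def)
      then have xS: "x \<in> S (stage (J h))" using i S_mono by (auto simp: S_def)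
      have le: "J h * T \<le> J (Suc h) * T" using Jmono[of h "Suc h"] by simp
      have a: "amp x (Qs h) (J h * T) = amp x q (J h * T)" using amp_eq[of "J h * T" h] by simp
      have b: "amp x (Qs (Suc h)) n = amp x q n" if "n \<le> J (Suc h) * T" for n using amp_eq[OF that] by simp
      have "(\<forall>n\<in>{J h * T..J (Suc h) * T}. real n * cmod (amp x (Qs (Suc h)) n) \<le> 4 * (real (J h * T) * cmod (amp x (Qs h) (J h * T)))) \<and>
        real (J (Suc h) * T) * cmod (amp x (Qs (Suc h)) (J (Suc h) * T)) \<le> real (J h * T) * cmod (amp x (Qs h) (J h * T))"
        using f(2)[of h] xS by (simp add: Q_def fi)
      then show ?thesis unfolding D_def a using b le by auto
    qed
    have D: "D h \<le> D I" if "h \<ge> I" for h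
      using that
    proof (induction h rule: dec_induct)
      case (step h)
      then show ?case using dec[of h] by simp
    qed simp
    have all: "\<forall>n. J I * T \<le> n \<and> n \<le> J h * T \<longrightarrow> real n * cmod (amp x q n) \<le> 4 * D I" if "h \<ge> I" for h
      using that
    proof (induction h rule: dec_induct)
      case base
      then show ?case by (auto simp: D_def)
    next
      case (step h)
      show ?case
      proof (intro allI impI)
        fix n assume n: "J I * T \<le> n \<and> n \<le> J (Suc h) * T"
        show "real n * cmod (amp x q n) \<le> 4 * D I"
        proof (cases "n \<le> J h * T")
          case True
          then show ?thesis using step.IH n by blast
        next
          case False
          then have "real n * cmod (amp x q n) \<le> 4 * D h" using dec[of h] step.hyps n by auto
          then show ?thesis using D[of h] step.hyps by simp
        qed
      qed
    qed
    have "cmod (amp x q n) \<le> 4 * D I / real n" if "n \<ge> J I * T + 1" for n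
    proof -
      have "n \<le> J (max I n) * T"
        using mult_le_mono[OF Ji(1)[of "max I n"] T_pos] by simp
      then have "real n * cmod (amp x q n) \<le> 4 * D I" using all[of "max I n"] that by simp
      then show ?thesis using that by (simp add: le_divide_eq mult.commute)
    qed
    then have bound: "(cmod (amp x q n))\<^sup>2 \<le> (4 * D I)\<^sup>2 * inverse (real n ^ 2)" if "n \<ge> J I * T + 1" for n
      using power_mono[of "cmod (amp x q n)" "4 * D I / real n" 2] that
      by (simp add: power_divide divide_inverse power_mult_distrib power_inverse)
    have "summable (\<lambda>n. (4 * D I)\<^sup>2 * inverse (real n ^ 2))"
      by (intro summable_mult inverse_power_summable) simp
    then show "summable (\<lambda>n. (cmod (amp x q n))\<^sup>2)"
    proof (rule summable_comparison_test')
      show "norm ((cmod (amp x q n))\<^sup>2) \<le> (4 * D I)\<^sup>2 * inverse (real n ^ 2)" if "n \<ge> J I * T + 1" for n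
        using bound[OF that] by (simp only: real_norm_def abs_power2)
    qed
  qed
qed

end

section \<open>Rationally independent quasi-momenta\<close>

text \<open>
  Each excluded coincidence is a relation with rational coefficients between \<open>\<pi>\<close> and one or two of the angles.
\<close>

lemma rationally_independent_angles:
  fixes \<theta> :: "nat \<Rightarrow> real"
  assumes "rationally_independent (pi # map \<theta> [3..<Suc n])" and i: "3 \<le> i" "i \<le> n"
  shows "2 * \<theta> i \<noteq> pi"
    and "\<lbrakk>3 \<le> j; j \<le> n; i \<noteq> j\<rbrakk> \<Longrightarrow> \<theta> i \<noteq> \<theta> j \<and> \<theta> i + \<theta> j \<noteq> pi"
proof -
  let ?S = "set (pi # map \<theta> [3..<Suc n])"
  interpret vector_space "\<lambda>(r :: rat) (x :: real). of_rat r * x"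
    by unfold_locales (simp_all add: algebra_simps of_rat_add of_rat_mult)
  have ind: "independent ?S" and dist: "distinct (pi # map \<theta> [3..<Suc n])"
    using assms(1) unfolding rationally_independent_def by blast+
  have mem: "\<theta> k \<in> ?S" "\<theta> k \<noteq> pi" if "3 \<le> k" "k \<le> n" for k
  proof -
    have "\<theta> k \<in> set (map \<theta> [3..<Suc n])" using that by (simp del: upt_Suc)
    then show "\<theta> k \<in> ?S" "\<theta> k \<noteq> pi" using dist by (simp del: upt_Suc, metis distinct.simps(2))
  qed
  have inj: "inj_on \<theta> {3..<Suc n}" using dist by (simp add: distinct_map del: upt_Suc)
  show "2 * \<theta> i \<noteq> pi"
  proof
    assume half: "2 * \<theta> i = pi"
    let ?u = "\<lambda>x. if x = pi then - 1 else 2 :: rat"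
    have "(\<Sum>x\<in>{pi, \<theta> i}. of_rat (?u x) * x) = 0" using mem(2)[OF i] half by simp
    from independentD[OF ind _ _ this, of pi] mem[OF i] show False by (simp del: upt_Suc)
  qed
  assume j: "3 \<le> j" "j \<le> n" "i \<noteq> j"
  have ne: "\<theta> i \<noteq> \<theta> j" using inj_onD[OF inj, of i j] i j by auto
  moreover have "\<theta> i + \<theta> j \<noteq> pi"
  proof
    assume total: "\<theta> i + \<theta> j = pi"
    let ?u = "\<lambda>x. if x = pi then - 1 else 1 :: rat"
    have "(\<Sum>x\<in>{pi, \<theta> i, \<theta> j}. of_rat (?u x) * x) = 0"
      using mem(2)[OF i] mem(2)[OF j(1,2)] ne total by simp
    from independentD[OF ind _ _ this, of pi] mem[OF i] mem[OF j(1,2)] show False by (simp del: upt_Suc)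
  qed
  ultimately show "\<theta> i \<noteq> \<theta> j \<and> \<theta> i + \<theta> j \<noteq> pi" by blast
qed

lemma cos_double_eqD:
  assumes "0 < s" "s < pi" "0 < t" "t < pi" "cos (2 * s) = cos (2 * t)"
  shows "s = t \<or> s + t = pi"
proof -
  have "(cos s)\<^sup>2 = (cos t)\<^sup>2" using assms(5) by (simp add: cos_double_cos)
  then consider "cos s = cos t" | "cos s = cos (pi - t)" by (auto simp: power2_eq_iff)
  then show ?thesis
    using cos_inj_pi[of s t] cos_inj_pi[of s "pi - t"] assms by cases auto
qed

lemma sin_double_nonzero:
  assumes "0 < s" "s < pi" "2 * s \<noteq> pi"
  shows "sin (2 * s) \<noteq> 0"
proof -
  have "cos s \<noteq> cos (pi / 2)" using cos_inj_pi[of s "pi / 2"] assms by auto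
  then show ?thesis using sin_gt_zero[of s] assms by (simp add: sin_double)
qed

theorem theorem4p4:
  fixes T :: nat and a b :: "nat \<Rightarrow> real" and lam :: "nat \<Rightarrow> real" and K :: "nat \<Rightarrow> real"
  assumes "periodic_jacobi_coeffs T a b"
    and "\<forall>i\<ge>3. lam i \<in> sigma_ell T a b"
    and "\<forall>n\<ge>3. rationally_independent
                (pi # map (\<lambda>i. quasi_momentum T a b (lam i)) [3..<Suc n])"
    and "{lam 1, lam 2} \<subseteq> sigma_ell T a b"
    and "(0 < quasi_momentum T a b (lam 1) \<and>
          quasi_momentum T a b (lam 1) < quasi_momentum T a b (lam 2) \<and>
          quasi_momentum T a b (lam 2) < pi / 2) \<or>
         (pi / 2 < quasi_momentum T a b (lam 1) \<and>
          quasi_momentum T a b (lam 1) < quasi_momentum T a b (lam 2) \<and>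
          quasi_momentum T a b (lam 2) < pi)"
    and "\<forall>n\<ge>1. K n > 0"
    and "filterlim K at_top sequentially"
  shows "\<exists>(q :: nat \<Rightarrow> real) (u :: nat \<Rightarrow> nat \<Rightarrow> real).
           is_potential q \<and>
           (\<forall>n\<ge>1. \<bar>q n\<bar> \<le> K n / real n) \<and>
           (\<forall>i\<ge>1. u i \<in> l2 \<and> u i \<noteq> (\<lambda>_. 0) \<and>
              (\<lambda>n. jacobi_op a b (u i) n + diag_op q (u i) n) = (\<lambda>n. lam i * u i n))"
proof -
  define \<theta> where "\<theta> i = quasi_momentum T a b (lam i)" for i
  define \<Lambda> where "\<Lambda> = lam ` {1..}"
  have ell: "lam i \<in> sigma_ell T a b" if "i \<ge> 1" for i
  proof -
    consider "i = 1" | "i = 2" | "i \<ge> 3" using \<open>i \<ge> 1\<close> by linarith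
    then show ?thesis using assms(2,4) by cases auto
  qed
  have \<theta>: "0 < \<theta> i" "\<theta> i < pi" if "i \<ge> 1" for i
    using quasi_momentum[OF assms(1) ell[OF that]] by (auto simp: \<theta>_def)
  have free: "2 * \<theta> i \<noteq> pi" "j \<ge> 3 \<Longrightarrow> i \<noteq> j \<Longrightarrow> cos (2 * \<theta> i) \<noteq> cos (2 * \<theta> j)" if "i \<ge> 3" for i j
  proof -
    have ri: "rationally_independent (pi # map \<theta> [3..<Suc n])" if "n \<ge> 3" for n
      using assms(3) that unfolding \<theta>_def by blast
    show "2 * \<theta> i \<noteq> pi" using rationally_independent_angles(1)[OF ri[of i]] that by simp
    assume j: "j \<ge> 3" "i \<noteq> j"
    have "\<theta> i \<noteq> \<theta> j \<and> \<theta> i + \<theta> j \<noteq> pi"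
      using rationally_independent_angles(2)[OF ri[of "max i j"], of i j] that j by simp
    then show "cos (2 * \<theta> i) \<noteq> cos (2 * \<theta> j)" using cos_double_eqD[of "\<theta> i" "\<theta> j"] \<theta> that j by auto
  qed
  have half: "2 * \<theta> i \<noteq> pi" if "i \<ge> 1" for i
  proof -
    consider "i = 1" | "i = 2" | "i \<ge> 3" using \<open>i \<ge> 1\<close> by linarith
    then show ?thesis using free(1)[of i] assms(5) unfolding \<theta>_def by cases auto
  qed
  have "cos (2 * \<theta> 1) \<noteq> cos (2 * \<theta> 2)"
    using cos_double_eqD[of "\<theta> 1" "\<theta> 2"] \<theta>[of 1] \<theta>[of 2] assms(5) unfolding \<theta>_def by auto
  then have pairs: "i \<le> 2 \<and> j \<ge> 3 \<or> i \<ge> 3 \<and> j \<le> 2"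
    if "i \<ge> 1" "j \<ge> 1" "i \<noteq> j" "cos (2 * \<theta> i) = cos (2 * \<theta> j)" for i j
  proof -
    have "\<not> (i \<ge> 3 \<and> j \<ge> 3)" using free(2)[of i j] that by auto
    moreover have "\<not> (i \<le> 2 \<and> j \<le> 2)"
    proof
      assume "i \<le> 2 \<and> j \<le> 2"
      then have "(i = 1 \<and> j = 2) \<or> (i = 2 \<and> j = 1)" using that by arith
      then show False using that(4) \<open>cos (2 * \<theta> 1) \<noteq> cos (2 * \<theta> 2)\<close> by auto
    qed
    ultimately show ?thesis by linarith
  qed
  have "\<exists>\<phi> \<zeta>. floquet T (ext_coeff T a) b x \<zeta> \<phi> \<and>
      (\<zeta> = exp (\<i> * quasi_momentum T a b x) \<or> \<zeta> = exp (- \<i> * quasi_momentum T a b x))" if "x \<in> \<Lambda>" for x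
  proof -
    have "x \<in> sigma_ell T a b" using \<open>x \<in> \<Lambda>\<close> ell by (auto simp: \<Lambda>_def)
    then show ?thesis using floquet_exists[OF assms(1)] by metis
  qed
  then obtain \<Phi> \<zeta> where fl: "\<And>x. x \<in> \<Lambda> \<Longrightarrow> floquet T (ext_coeff T a) b x (\<zeta> x) (\<Phi> x)"
    and \<zeta>: "\<And>x. x \<in> \<Lambda> \<Longrightarrow> \<zeta> x = exp (\<i> * quasi_momentum T a b x) \<or> \<zeta> x = exp (- \<i> * quasi_momentum T a b x)"
    by metis
  have sq: "Re ((\<zeta> (lam i))\<^sup>2) = cos (2 * \<theta> i)" "\<bar>Im ((\<zeta> (lam i))\<^sup>2)\<bar> = \<bar>sin (2 * \<theta> i)\<bar>" if "i \<ge> 1" for i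
  proof -
    have "\<zeta> (lam i) = exp (\<i> * \<theta> i) \<or> \<zeta> (lam i) = exp (- \<i> * \<theta> i)"
      using \<zeta>[of "lam i"] that by (auto simp: \<theta>_def \<Lambda>_def)
    moreover have "(exp (\<i> * \<theta> i))\<^sup>2 = exp (\<i> * complex_of_real (2 * \<theta> i))"
      "(exp (- \<i> * \<theta> i))\<^sup>2 = exp (- \<i> * complex_of_real (2 * \<theta> i))"
      unfolding exp_double[symmetric] by (simp_all add: mult.left_commute)
    ultimately have "(\<zeta> (lam i))\<^sup>2 = exp (\<i> * complex_of_real (2 * \<theta> i)) \<or>
        (\<zeta> (lam i))\<^sup>2 = exp (- \<i> * complex_of_real (2 * \<theta> i))"
      by auto
    then show "Re ((\<zeta> (lam i))\<^sup>2) = cos (2 * \<theta> i)" "\<bar>Im ((\<zeta> (lam i))\<^sup>2)\<bar> = \<bar>sin (2 * \<theta> i)\<bar>"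
      by (auto simp: Re_exp Im_exp)
  qed
  interpret resonance_family T "ext_coeff T a" b \<Lambda> \<Phi> \<zeta>
  proof
    show "T \<ge> 1" using assms(1) by (simp add: periodic_jacobi_coeffs_def)
    show "ext_coeff T a n > 0" for n by (rule ext_coeff_pos[OF assms(1)])
    show "floquet T (ext_coeff T a) b x (\<zeta> x) (\<Phi> x)" if "x \<in> \<Lambda>" for x by (rule fl[OF that])
    show "Im ((\<zeta> x)\<^sup>2) \<noteq> 0" if "x \<in> \<Lambda>" for x
      using that sq(2) sin_double_nonzero[OF \<theta> half] by (fastforce simp: \<Lambda>_def)
    fix x y z assume x: "x \<in> \<Lambda>" "y \<in> \<Lambda>" "z \<in> \<Lambda>"
      and eq: "Re ((\<zeta> x)\<^sup>2) = Re ((\<zeta> y)\<^sup>2)" "Re ((\<zeta> y)\<^sup>2) = Re ((\<zeta> z)\<^sup>2)"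
    obtain i j k where ijk: "i \<ge> 1" "j \<ge> 1" "k \<ge> 1" "x = lam i" "y = lam j" "z = lam k"
      using x by (auto simp: \<Lambda>_def)
    have "cos (2 * \<theta> i) = cos (2 * \<theta> j)" "cos (2 * \<theta> j) = cos (2 * \<theta> k)" using eq ijk sq(1) by auto
    then have "i = j \<or> i = k \<or> j = k" using pairs[of i j] pairs[of j k] pairs[of i k] ijk by linarith
    then show "x = y \<or> x = z \<or> y = z" using ijk by auto
  qed
  \<comment> \<open>resonances occur between one of the first two energies and at most one later energy each\<close>
  have "\<exists>k0. \<forall>i j. i \<ge> 1 \<and> j \<ge> 1 \<and> i \<noteq> j \<and> cos (2 * \<theta> i) = cos (2 * \<theta> j) \<longrightarrow> i \<le> k0"
  proof -
    have fin: "finite {i. i \<ge> 3 \<and> cos (2 * \<theta> i) = c}" for c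
    proof (cases "\<exists>k\<ge>3. cos (2 * \<theta> k) = c")
      case True
      then obtain k where "k \<ge> 3" "cos (2 * \<theta> k) = c" by blast
      then have "{i. i \<ge> 3 \<and> cos (2 * \<theta> i) = c} \<subseteq> {k}" using free(2) by blast
      then show ?thesis by (rule finite_subset) simp
    next
      case False
      then have "{i. i \<ge> 3 \<and> cos (2 * \<theta> i) = c} = {}" by blast
      then show ?thesis by (simp only: finite.emptyI)
    qed
    let ?F = "{i. i \<ge> 3 \<and> cos (2 * \<theta> i) = cos (2 * \<theta> 1)} \<union> {i. i \<ge> 3 \<and> cos (2 * \<theta> i) = cos (2 * \<theta> 2)} \<union> {2}"
    have F: "finite ?F" using fin by auto
    show ?thesis
    proof (intro exI[of _ "Max ?F"] allI impI)
      fix i j assume h: "i \<ge> 1 \<and> j \<ge> 1 \<and> i \<noteq> j \<and> cos (2 * \<theta> i) = cos (2 * \<theta> j)"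
      show "i \<le> Max ?F"
      proof (cases "i \<le> 2")
        case True
        moreover have "2 \<le> Max ?F" using F by (intro Max_ge) auto
        ultimately show ?thesis by linarith
      next
        case False
        then have "i \<ge> 3" "j = 1 \<or> j = 2" using pairs[of i j] h by linarith+
        then have "i \<in> ?F" using h by auto
        then show ?thesis using F by (intro Max_ge)
      qed
    qed
  qed
  then obtain k0 where k0: "\<And>i j. \<lbrakk>i \<ge> 1; j \<ge> 1; i \<noteq> j; cos (2 * \<theta> i) = cos (2 * \<theta> j)\<rbrakk> \<Longrightarrow> i \<le> k0" by blast
  have mir: "x \<in> lam ` {1..k0}" if xy: "x \<in> \<Lambda>" "y \<in> \<Lambda>" "mirror x y" for x y
  proof -
    obtain i j where ij: "i \<ge> 1" "j \<ge> 1" "x = lam i" "y = lam j" using xy by (auto simp: \<Lambda>_def)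
    have "Re ((\<zeta> y)\<^sup>2) = Re ((\<zeta> x)\<^sup>2)" using mirror_multiplier[OF xy] by (simp del: complex_cnj_power)
    then have "cos (2 * \<theta> i) = cos (2 * \<theta> j)" using sq(1) ij by simp
    moreover have "i \<noteq> j" using mirror_irrefl xy ij by auto
    ultimately show ?thesis using k0[of i j] ij by auto
  qed
  \<comment> \<open>a bound of order \<open>sqrt n\<close> on the numerator makes the potential tend to zero\<close>
  define K' where "K' n = min (K n) (sqrt (real n))" for n
  have K'pos: "K' n > 0" if "n \<ge> 1" for n using assms(6) that by (simp add: K'_def)
  have K'lim: "filterlim K' at_top sequentially"
  proof -
    have "filterlim (\<lambda>n. sqrt (real n)) at_top sequentially" by real_asymp
    then show ?thesis using assms(7) unfolding filterlim_at_top K'_def by (auto intro: eventually_conj)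
  qed
  obtain q where q: "\<And>n. n \<ge> 1 \<Longrightarrow> \<bar>q n\<bar> \<le> K' n / real n"
    and sum: "\<And>x. x \<in> \<Lambda> \<Longrightarrow> summable (\<lambda>n. (cmod (amp x q n))\<^sup>2)"
  proof (rule decaying_solutions[where K = K' and ?k0.0 = k0, OF \<Lambda>_def])
    show "x \<in> lam ` {1..k0}" if "x \<in> \<Lambda>" "y \<in> \<Lambda>" "mirror x y" for x y using mir[OF that] .
    show "K' n > 0" if "n \<ge> 1" for n using K'pos[OF that] .
    show "filterlim K' at_top sequentially" by (rule K'lim)
  qed blast
  have "is_potential q"
    unfolding is_potential_def
  proof (rule Lim_null_comparison)
    show "\<forall>\<^sub>F n in sequentially. norm (q n) \<le> sqrt (real n) / real n"
      using eventually_ge_at_top[of 1]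
    proof eventually_elim
      case (elim n)
      have "K' n / real n \<le> sqrt (real n) / real n" by (intro divide_right_mono) (auto simp: K'_def)
      then show ?case using q[OF elim] by simp
    qed
    show "(\<lambda>n. sqrt (real n) / real n) \<longlonglongrightarrow> 0" by real_asymp
  qed
  moreover have "\<bar>q n\<bar> \<le> K n / real n" if "n \<ge> 1" for n
  proof -
    have "K' n / real n \<le> K n / real n" by (intro divide_right_mono) (auto simp: K'_def)
    then show ?thesis using q[OF that] by linarith
  qed
  moreover have "solution (lam i) q \<in> l2 \<and> solution (lam i) q \<noteq> (\<lambda>_. 0) \<and>
      (\<lambda>n. jacobi_op a b (solution (lam i) q) n + diag_op q (solution (lam i) q) n)
        = (\<lambda>n. lam i * solution (lam i) q n)" if i: "i \<ge> 1" for i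
  proof (intro conjI ext)
    have x: "lam i \<in> \<Lambda>" using i by (auto simp: \<Lambda>_def)
    let ?u = "solution (lam i) q"
    have "(?u n)\<^sup>2 \<le> (\<Sum>k<T. (cmod (\<Phi> (lam i) k))\<^sup>2) * (cmod (amp (lam i) q n))\<^sup>2" for n
    proof -
      have "(?u n)\<^sup>2 \<le> (cmod (\<Phi> (lam i) n * amp (lam i) q n))\<^sup>2"
        unfolding solution_def using abs_Re_le_cmod by (metis abs_norm_cancel power2_le_iff_abs_le norm_ge_zero)
      also have "\<dots> = (cmod (\<Phi> (lam i) n))\<^sup>2 * (cmod (amp (lam i) q n))\<^sup>2"
        by (simp add: norm_mult power_mult_distrib)
      also have "\<dots> \<le> (\<Sum>k<T. (cmod (\<Phi> (lam i) k))\<^sup>2) * (cmod (amp (lam i) q n))\<^sup>2"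
        using solution_bounded[OF x] by (intro mult_right_mono) auto
      finally show ?thesis .
    qed
    then have "summable (\<lambda>n. (?u n)\<^sup>2)"
      by (intro summable_comparison_test'[OF summable_mult[OF sum[OF x]], of 0]) auto
    then show "?u \<in> l2" by (simp add: l2_def solution_0)
    show "?u \<noteq> (\<lambda>_. 0)" using solution_1[OF x, of q] by (metis zero_neq_one)
    fix n
    show "jacobi_op a b ?u n + diag_op q ?u n = lam i * ?u n"
    proof (cases n)
      case 0
      then show ?thesis by (simp add: jacobi_op_def diag_op_def solution_0)
    next
      case (Suc k)
      show ?thesis
        using solution_equation[OF x, of k q] Suc
        by (cases k) (simp_all add: jacobi_op_def diag_op_def ext_coeff_def solution_0 algebra_simps
            flip: numeral_2_eq_2)
    qed
  qed
  ultimately show ?thesis by (intro exI[of _ q] exI[of _ "\<lambda>i. solution (lam i) q"]) blast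
qed

end
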